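(* For every integer $D\ge 1$ there exists $n_0$ such that for all $n\ge n_0$ there is a graph $\Gamma$ with at most \[80000\,n^{2-1/D}(\log n)^{2/D}(\log\log n)^5\] edges that is $\mathcal{H}(n,D)$-universal, i.e. $\Gamma$ contains a copy of every $n$-vertex $D$-degenerate graph as a subgraph.
   Context: A graph $H$ is $D$-degenerate if every induced subgraph of $H$ has a vertex of degree at most $D$. $\mathcal{H}(n,D)$ denotes the family of all $n$-vertex graphs of degeneracy at most $D$ (with no restriction on the maximum degree). A graph is $\mathcal{H}$-universal if it contains every member of $\mathcal{H}$ as a subgraph. $\log$ denotes the natural logarithm. *)

theory Defs
  imports Complex_Main
begin

definition simple_graph :: "'a set \<Rightarrow> 'a set set \<Rightarrow> bool" where
  "simple_graph V E \<longleftrightarrow> finite V \<and> (\<forall>e\<in>E. e \<subseteq> V \<and> card e = 2)"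

definition degenerate :: "'a set \<Rightarrow> 'a set set \<Rightarrow> nat \<Rightarrow> bool" where
  "degenerate V E D \<longleftrightarrow>
     (\<forall>S. S \<subseteq> V \<and> S \<noteq> {} \<longrightarrow> (\<exists>u\<in>S. card {v\<in>S. {u, v} \<in> E} \<le> D))"

definition contains_subgraph :: "'a set \<Rightarrow> 'a set set \<Rightarrow> 'b set \<Rightarrow> 'b set set \<Rightarrow> bool" where
  "contains_subgraph VG EG VH EH \<longleftrightarrow>
     (\<exists>f. inj_on f VH \<and> f ` VH \<subseteq> VG \<and> (\<forall>e\<in>EH. f ` e \<in> EG))"

text \<open>H(n,D)-universal: contains every n-vertex graph of degeneracy at most D
  (n-vertex graphs are taken, up to isomorphism, on the vertex set {0..<n}).\<close>
definition universal :: "nat \<Rightarrow> nat \<Rightarrow> 'b set \<Rightarrow> 'b set set \<Rightarrow> bool" where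
  "universal n D VG EG \<longleftrightarrow>
     (\<forall>EH. simple_graph {0..<n} EH \<and> degenerate {0..<n} EH D
        \<longrightarrow> contains_subgraph VG EG {0..<n::nat} EH)"

end

(* The host graph has levels 0, ..., h - 1, where 2^h is between 2n and 4n and level i has 2^(h-i)
   vertices. A vertex a of level j is joined to each vertex of level i at random with probability about
   ((2^j + h) / 2^(h-i))^(1/D). Embed the vertices greedily in a degeneracy order; a vertex starts at the
   first level whose threshold 4D 2^i exceeds its number of later neighbours, and moves to the next level
   when all common neighbours of its (at most D) embedded neighbours are occupied.

   A vertex moves on from level i only if one of its embedded neighbours sits at a host vertex that is
   exceptional for the occupied set Z of level i. The exponential moment of the total threshold of the
   exceptional vertices beats the union bound over all sets Z, so this total is at most 1/8 of the
   size of the level, uniformly in Z, and hence every level stays at least half free. *)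

theory Submission
  imports Defs "HOL-Library.FuncSet" "HOL-Library.Nat_Bijection" "HOL-Real_Asymp.Real_Asymp"
begin


section \<open>Random bipartite graphs\<close>

text \<open>For one host vertex the failure probability is far above 2^(-|W|), so no union bound
  over the occupied sets \<open>Z\<close> of a level \<open>W\<close> can rule out every failure.
  Failures are allowed instead, and a failing vertex is charged its threshold, which bounds the
  number of later vertices it can push on. Different host vertices fail independently, so the
  weighted total has a bounded exponential moment, and that is what defeats the 2^|W| choices of
  \<open>Z\<close>.

  In the density, the term 2^j pays for the charge 4D 2^j of a vertex of level j, and h pays for the
  choice among the lists of at most D neighbours. The edges consist of D independent random
  relations, one per position in the list, so that the candidate sets of a round are fixed before
  the round is drawn. Running through a list by decreasing level makes the densities nonincreasing:
  what is left when \<open>a\<close> is reached is bounded below in terms of the density of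
  \<open>a\<close> alone. At most D rounds cost at most a factor density^D up to constants, whence
  the exponent 1/D.

  The edge count is C(D) n^(2-1/D) (ln n)^(2/D); the power of ln ln n absorbs C(D).\<close>

definition subset_weight :: "'w set \<Rightarrow> real \<Rightarrow> 'w set \<Rightarrow> real" where
  "subset_weight W q A = q ^ card A * (1 - q) ^ card (W - A)"

lemma ln_2_le_1: "ln (2::real) \<le> 1"
  using ln_le_minus_one[of "2::real"] by simp

lemma subset_weight_nonneg:
  assumes "0 \<le> q" "q \<le> 1"
  shows "0 \<le> subset_weight W q A"
  using assms by (simp add: subset_weight_def)

text \<open>Generating function of a binomial variable: under \<open>subset_weight\<close> each
  element of \<open>W\<close> is chosen independently with probability \<open>q\<close>. It is
  evaluated at x = 1 for the total mass, x = 0 for the inclusion probability and x = 1/2 for the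
  lower tail. All expectations stay finite sums.\<close>

lemma sum_subset_weight_power:
  assumes "finite W" "B \<subseteq> W"
  shows "(\<Sum>A\<in>Pow W. subset_weight W q A * x ^ card (A \<inter> B)) = (1 - q + q * x) ^ card B"
proof -
  have "(\<Prod>w\<in>A. q * (if w \<in> B then x else 1)) = q ^ card A * x ^ card (A \<inter> B)"
    if "A \<subseteq> W" for A
  proof -
    have "finite A" using assms(1) finite_subset that by blast
    then have "(\<Prod>w\<in>A. (if w \<in> B then x else 1)) = x ^ card (A \<inter> B)"
      by (simp add: prod.If_cases Int_def)
    then show ?thesis by (simp add: prod.distrib)
  qed
  then have "(\<Sum>A\<in>Pow W. subset_weight W q A * x ^ card (A \<inter> B))
     = (\<Sum>A\<in>Pow W. (\<Prod>w\<in>A. q * (if w \<in> B then x else 1)) * (\<Prod>w\<in>W-A. 1 - q))"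
    by (intro sum.cong) (auto simp: subset_weight_def)
  also have "\<dots> = (\<Prod>w\<in>W. q * (if w \<in> B then x else 1) + (1 - q))"
    using assms(1) by (simp add: prod_add)
  also have "\<dots> = (\<Prod>w\<in>W. if w \<in> B then 1 - q + q * x else 1)"
    by (intro prod.cong) auto
  also have "\<dots> = (1 - q + q * x) ^ card B"
  proof -
    have "W \<inter> B = B" using assms by auto
    then show ?thesis using assms by (simp add: prod.If_cases Int_def)
  qed
  finally show ?thesis .
qed

lemma sum_subset_weight: "finite W \<Longrightarrow> (\<Sum>A\<in>Pow W. subset_weight W q A) = 1"
  using sum_subset_weight_power[of W "{}" q 1] by simp

lemma sum_subset_weight_card:
  assumes "finite W"
  shows "(\<Sum>A\<in>Pow W. subset_weight W q A * real (card A)) = q * real (card W)"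
proof -
  have one: "(\<Sum>A\<in>Pow W. subset_weight W q A * of_bool (w \<in> A)) = q" if "w \<in> W" for w
  proof -
    \<comment> \<open>Uses 0^0 = 1, so the indicator becomes a value of the generating
      function.\<close>
    have "of_bool (w \<in> A) = 1 - (0::real) ^ card (A \<inter> {w})" for A by (cases "w \<in> A") auto
    then have "(\<Sum>A\<in>Pow W. subset_weight W q A * of_bool (w \<in> A))
      = (\<Sum>A\<in>Pow W. subset_weight W q A) - (\<Sum>A\<in>Pow W. subset_weight W q A * 0 ^ card (A \<inter> {w}))"
      by (simp only: right_diff_distrib sum_subtractf mult_1_right)
    also have "\<dots> = q"
      using sum_subset_weight_power[of W "{w}" q 0] sum_subset_weight[of W q] assms that by simp
    finally show ?thesis .
  qed
  have "(\<Sum>A\<in>Pow W. subset_weight W q A * real (card A))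
      = (\<Sum>A\<in>Pow W. \<Sum>w\<in>W. subset_weight W q A * of_bool (w \<in> A))"
  proof (intro sum.cong refl)
    fix A assume "A \<in> Pow W"
    then have "W \<inter> A = A" by auto
    then have "real (card A) = (\<Sum>w\<in>W. of_bool (w \<in> A))"
      using assms by (simp add: Int_def)
    then show "subset_weight W q A * real (card A) = (\<Sum>w\<in>W. subset_weight W q A * of_bool (w \<in> A))"
      by (simp only: sum_distrib_left)
  qed
  also have "\<dots> = (\<Sum>w\<in>W. q)"
    by (subst sum.swap) (intro sum.cong refl one)
  finally show ?thesis by simp
qed

text \<open>Chernoff bound, with the moment generating function evaluated at base \<open>1/2\<close>.\<close>
lemma subset_weight_lower_tail:
  assumes "finite W" "B \<subseteq> W" "0 \<le> q" "q \<le> 1"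
  shows "(\<Sum>A\<in>Pow W. subset_weight W q A * of_bool (real (card (A \<inter> B)) < q / 4 * card B))
         \<le> exp (- (q * card B / 4))"
proof -
  let ?b = "real (card B)"
  have "(\<Sum>A\<in>Pow W. subset_weight W q A * of_bool (real (card (A \<inter> B)) < q / 4 * card B))
     \<le> (\<Sum>A\<in>Pow W. subset_weight W q A * ((1/2) ^ card (A \<inter> B) * 2 powr (q / 4 * ?b)))"
  proof (intro sum_mono mult_left_mono)
    fix A
    show "of_bool (real (card (A \<inter> B)) < q / 4 * card B) \<le> (1/2) ^ card (A \<inter> B) * 2 powr (q / 4 * ?b)"
    proof (cases "real (card (A \<inter> B)) < q / 4 * card B")
      case True
      then have "(2::real) powr card (A \<inter> B) \<le> 2 powr (q / 4 * ?b)" by simp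
      then show ?thesis using True by (simp add: powr_realpow power_divide field_simps)
    qed auto
  qed (auto intro: subset_weight_nonneg assms)
  also have "\<dots> = 2 powr (q / 4 * ?b) * (1 - q + q * (1/2)) ^ card B"
    using sum_subset_weight_power[OF assms(1,2), of q "1/2"]
    by (simp add: mult.assoc[symmetric] sum_distrib_right[symmetric])
  also have "\<dots> = 2 powr (q / 4 * ?b) * (1 - q / 2) ^ card B" by (simp add: algebra_simps)
  \<comment> \<open>Cutting at a quarter of the mean lets 2 be replaced by e in the first factor;
    the exponents add up to q/4 - q/2 = -q/4.\<close>
  also have "\<dots> \<le> exp (q / 4 * ?b) * exp (- q / 2) ^ card B"
  proof (intro mult_mono power_mono)
    have "q / 4 * ?b * ln 2 \<le> q / 4 * ?b * 1"
      using assms ln_2_le_1 by (intro mult_left_mono) auto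
    then show "2 powr (q / 4 * ?b) \<le> exp (q / 4 * ?b)" by (simp add: powr_def)
    show "1 - q / 2 \<le> exp (- q / 2)" using exp_ge_add_one_self[of "-q/2"] by simp
  qed (use assms in auto)
  also have "\<dots> = exp (- (q * card B / 4))"
    by (simp add: exp_of_nat_mult[symmetric] exp_add[symmetric] field_simps)
  finally show ?thesis .
qed

text \<open>The bad event of one host vertex in one round: \<open>QQ\<close> collects the possible
  common neighbourhoods of the vertices met before, and \<open>t\<close> discards those whose free
  part is too small for concentration.\<close>

definition thin :: "'w set set \<Rightarrow> real \<Rightarrow> real \<Rightarrow> 'w set \<Rightarrow> 'w set \<Rightarrow> bool" where
  "thin QQ q t Z A \<longleftrightarrow> (\<exists>Q\<in>QQ. t \<le> real (card (Q - Z)) \<and>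
     real (card (A \<inter> (Q - Z))) < q / 4 * card (Q - Z))"

text \<open>Union bound over \<open>QQ\<close> with \<open>Z\<close> fixed; the choice of
  \<open>Z\<close> is paid for later by the exponential moment.\<close>

lemma subset_weight_thin:
  assumes "finite W" "QQ \<subseteq> Pow W" "0 \<le> q" "q \<le> 1"
  shows "(\<Sum>A\<in>Pow W. subset_weight W q A * of_bool (thin QQ q t Z A)) \<le> card QQ * exp (- (q * t / 4))"
proof -
  have fin: "finite QQ" using assms finite_subset by blast
  let ?ev = "\<lambda>Q A. t \<le> real (card (Q - Z)) \<and> real (card (A \<inter> (Q - Z))) < q / 4 * card (Q - Z)"
  have "(\<Sum>A\<in>Pow W. subset_weight W q A * of_bool (thin QQ q t Z A))
    \<le> (\<Sum>A\<in>Pow W. \<Sum>Q\<in>QQ. subset_weight W q A * of_bool (?ev Q A))"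
  proof (intro sum_mono)
    fix A
    have "of_bool (thin QQ q t Z A) \<le> (\<Sum>Q\<in>QQ. of_bool (?ev Q A) :: real)"
    proof (cases "thin QQ q t Z A")
      case True
      then obtain Q where "Q \<in> QQ" "?ev Q A" by (auto simp: thin_def)
      then show ?thesis using member_le_sum[of Q QQ "\<lambda>Q. of_bool (?ev Q A) :: real"] fin True by auto
    qed (simp add: sum_nonneg)
    then show "subset_weight W q A * of_bool (thin QQ q t Z A)
        \<le> (\<Sum>Q\<in>QQ. subset_weight W q A * of_bool (?ev Q A))"
      unfolding sum_distrib_left[symmetric]
      by (intro mult_left_mono) (auto intro: subset_weight_nonneg assms)
  qed
  also have "\<dots> = (\<Sum>Q\<in>QQ. \<Sum>A\<in>Pow W. subset_weight W q A * of_bool (?ev Q A))"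
    by (rule sum.swap)
  also have "\<dots> \<le> (\<Sum>Q\<in>QQ. exp (- (q * t / 4)))"
  proof (intro sum_mono)
    fix Q assume "Q \<in> QQ"
    show "(\<Sum>A\<in>Pow W. subset_weight W q A * of_bool (?ev Q A)) \<le> exp (- (q * t / 4))"
    proof (cases "t \<le> real (card (Q - Z))")
      case True
      have "(\<Sum>A\<in>Pow W. subset_weight W q A * of_bool (?ev Q A)) \<le> exp (- (q * card (Q - Z) / 4))"
        using subset_weight_lower_tail[of W "Q - Z" q] True assms \<open>Q \<in> QQ\<close> by auto
      also have "\<dots> \<le> exp (- (q * t / 4))"
        using True assms by (auto intro!: mult_left_mono divide_right_mono)
      finally show ?thesis .
    qed simp
  qed
  finally show ?thesis by simp
qed

text \<open>At density 1 only A = W has positive weight. This covers the capped densities, for which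
  the smallness condition of the next lemmas is not assumed.\<close>

lemma subset_weight_thin_one:
  assumes "finite W" "QQ \<subseteq> Pow W" "0 < t"
  shows "(\<Sum>A\<in>Pow W. subset_weight W 1 A * of_bool (thin QQ 1 t Z A)) = 0"
proof (intro sum.neutral ballI)
  fix A assume A: "A \<in> Pow W"
  show "subset_weight W 1 A * of_bool (thin QQ 1 t Z A) = 0"
  proof (cases "A = W")
    case True
    have "W \<inter> (Q - Z) = Q - Z" if "Q \<in> QQ" for Q using assms that by auto
    then have "\<not> thin QQ 1 t Z A" using assms by (auto simp: thin_def True)
    then show ?thesis by simp
  next
    case False
    then have "card (W - A) \<noteq> 0" using A assms(1) by auto
    then show ?thesis by (simp add: subset_weight_def)
  qed
qed

section \<open>Controlling all occupied sets in one random round\<close>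

lemma exists_score_less_one:
  fixes wt score :: "'a \<Rightarrow> real"
  assumes "(\<Sum>x\<in>X. wt x) = 1" "\<And>x. x \<in> X \<Longrightarrow> 0 \<le> wt x" "(\<Sum>x\<in>X. wt x * score x) < 1"
  shows "\<exists>x\<in>X. score x < 1"
proof (rule ccontr)
  assume "\<not> ?thesis"
  then have "(\<Sum>x\<in>X. wt x) \<le> (\<Sum>x\<in>X. wt x * score x)"
    using assms(2) mult_left_mono[of 1 "score x" "wt x" for x] by (intro sum_mono) (force simp: not_less)
  then show False using assms by simp
qed


text \<open>First moment method. \<open>small\<close> bounds the contribution of each vertex to the
  exponential moment by 1 + 1/|Y|, and 2|W| \<le> c M lets the tail at \<open>M\<close> outweigh the
  2^|W| sets \<open>Z\<close>.\<close>

lemma one_round: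
  fixes W :: "'w set" and Y :: "'y set" and p \<delta> t :: "'y \<Rightarrow> real" and c M :: real
  assumes W: "finite W" "card W \<ge> 2" and Y: "finite Y" and QQ: "QQ \<subseteq> Pow W"
    and p: "\<And>y. y \<in> Y \<Longrightarrow> 0 < p y \<and> p y \<le> 1"
    and \<delta>: "\<And>y. y \<in> Y \<Longrightarrow> 0 \<le> \<delta> y"
    and t: "\<And>y. y \<in> Y \<Longrightarrow> 0 < t y"
    and cM: "0 < c" "2 * card W \<le> c * M"
    and small: "\<And>y. y \<in> Y \<Longrightarrow> p y < 1 \<Longrightarrow>
       card Y * (exp (c * \<delta> y) * (card QQ * exp (- (p y * t y / 4)))) \<le> 1"
  shows "\<exists>F. (\<forall>y\<in>Y. F y \<subseteq> W) \<and> (\<Sum>y\<in>Y. real (card (F y))) \<le> 4 * card W * (\<Sum>y\<in>Y. p y) \<and>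
     (\<forall>Z\<subseteq>W. (\<Sum>y | y \<in> Y \<and> thin QQ (p y) (t y) Z (F y). \<delta> y) \<le> M)"
proof (cases "Y = {}")
  case True
  have "0 < c * M" using W cM by linarith
  then have "0 \<le> M" using cM by (simp add: zero_less_mult_iff)
  then show ?thesis using True by auto
next
  case False
  define \<Omega> where "\<Omega> = PiE Y (\<lambda>_. Pow W)"
  define wt where "wt F = (\<Prod>y\<in>Y. subset_weight W (p y) (F y))" for F
  define N where "N = real (card W)"
  define mean where "mean = N * (\<Sum>y\<in>Y. p y)"
  have N: "N \<ge> 2" using W by (simp add: N_def)
  have mean_pos: "mean > 0"
    unfolding mean_def using N False Y p by (intro mult_pos_pos sum_pos) auto
  have cardY: "real (card Y) > 0" using Y False by (simp add: card_gt_0_iff)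
  \<comment> \<open>Independence of the coordinates: every expectation below is an instance of this
    factorization.\<close>
  have moment: "(\<Sum>F\<in>\<Omega>. wt F * (\<Prod>y\<in>Y. g y (F y)))
      = (\<Prod>y\<in>Y. \<Sum>A\<in>Pow W. subset_weight W (p y) A * g y A)" for g :: "'y \<Rightarrow> 'w set \<Rightarrow> real"
    unfolding \<Omega>_def wt_def prod.distrib[symmetric] using W Y by (subst prod_sum_PiE) auto
  have wt_sum: "(\<Sum>F\<in>\<Omega>. wt F) = 1"
    using moment[of "\<lambda>_ _. 1"] sum_subset_weight[OF W(1)] by simp
  have wt_nonneg: "0 \<le> wt F" for F
    unfolding wt_def using p by (intro prod_nonneg ballI subset_weight_nonneg) (auto simp: less_imp_le)
  define edges where "edges F = (\<Sum>y\<in>Y. real (card (F y)))" for F :: "'y \<Rightarrow> 'w set"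
  have edges_mean: "(\<Sum>F\<in>\<Omega>. wt F * edges F) = mean"
  proof -
    have "(\<Sum>F\<in>\<Omega>. wt F * real (card (F z))) = p z * N" if z: "z \<in> Y" for z
    proof -
      have "(\<Prod>y\<in>Y. if y = z then real (card (F y)) else 1) = real (card (F z))" for F :: "'y \<Rightarrow> 'w set"
        using Y z by (simp add: prod.delta)
      then have "(\<Sum>F\<in>\<Omega>. wt F * real (card (F z)))
          = (\<Prod>y\<in>Y. \<Sum>A\<in>Pow W. subset_weight W (p y) A * (if y = z then real (card A) else 1))"
        using moment[of "\<lambda>y A. if y = z then real (card A) else 1"] by simp
      also have "\<dots> = (\<Prod>y\<in>Y. if y = z then p y * N else 1)"
        using sum_subset_weight[OF W(1)] sum_subset_weight_card[OF W(1)]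
        by (intro prod.cong) (auto simp: N_def)
      finally show ?thesis using Y z by (simp add: prod.delta)
    qed
    then have "(\<Sum>F\<in>\<Omega>. wt F * edges F) = (\<Sum>y\<in>Y. p y * N)"
      unfolding edges_def sum_distrib_left by (subst sum.swap) simp
    then show ?thesis by (simp add: mean_def sum_distrib_left mult.commute)
  qed
  define ev where "ev Z y A = thin QQ (p y) (t y) Z A" for Z y A
  define load where "load Z F = (\<Sum>y\<in>Y. of_bool (ev Z y (F y)) * \<delta> y)" for Z F
  have load_mgf: "(\<Sum>F\<in>\<Omega>. wt F * exp (c * load Z F)) \<le> exp 1" for Z
  proof -
    have "exp (c * load Z F) = (\<Prod>y\<in>Y. exp (c * \<delta> y * of_bool (ev Z y (F y))))" for F
      using Y unfolding load_def by (subst exp_sum[symmetric]) (simp_all only: sum_distrib_left mult_ac)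
    then have "(\<Sum>F\<in>\<Omega>. wt F * exp (c * load Z F))
       = (\<Prod>y\<in>Y. \<Sum>A\<in>Pow W. subset_weight W (p y) A * exp (c * \<delta> y * of_bool (ev Z y A)))"
      using moment[of "\<lambda>y A. exp (c * \<delta> y * of_bool (ev Z y A))"] by simp
    \<comment> \<open>Each factor is at most 1 + exp(c * \<delta> y) P(bad) \<le> 1 + 1/|Y|, so the
      product over \<open>Y\<close> stays below e.\<close>
    also have "\<dots> \<le> (\<Prod>y\<in>Y. exp (1 / card Y))"
    proof (intro prod_mono conjI)
      fix y assume y: "y \<in> Y"
      note p' = p[OF y]
      show "0 \<le> (\<Sum>A\<in>Pow W. subset_weight W (p y) A * exp (c * \<delta> y * of_bool (ev Z y A)))"
        using p' by (intro sum_nonneg mult_nonneg_nonneg subset_weight_nonneg) auto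
      let ?P = "\<Sum>A\<in>Pow W. subset_weight W (p y) A * of_bool (ev Z y A)"
      have "card Y * (exp (c * \<delta> y) * ?P) \<le> 1"
      proof (cases "p y < 1")
        case True
        have "card Y * (exp (c * \<delta> y) * ?P)
            \<le> card Y * (exp (c * \<delta> y) * (card QQ * exp (- (p y * t y / 4))))"
          unfolding ev_def using p'
          by (intro mult_left_mono subset_weight_thin[OF W(1) QQ]) auto
        also have "\<dots> \<le> 1" using small[OF y True] .
        finally show ?thesis .
      next
        case False
        then have "?P = 0" using subset_weight_thin_one[OF W(1) QQ t[OF y]] p' by (simp add: ev_def)
        then show ?thesis by simp
      qed
      then have P: "exp (c * \<delta> y) * ?P \<le> 1 / card Y" using cardY by (simp add: field_simps)
      have "(\<Sum>A\<in>Pow W. subset_weight W (p y) A * exp (c * \<delta> y * of_bool (ev Z y A)))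
         \<le> (\<Sum>A\<in>Pow W. subset_weight W (p y) A * (1 + exp (c * \<delta> y) * of_bool (ev Z y A)))"
        using p' by (intro sum_mono mult_left_mono subset_weight_nonneg) auto
      also have "\<dots> = 1 + exp (c * \<delta> y) * ?P"
        by (simp add: distrib_left sum.distrib sum_subset_weight[OF W(1)] sum_distrib_left mult_ac)
      also have "\<dots> \<le> exp (1 / card Y)"
        using P exp_ge_add_one_self[of "1 / real (card Y)"] by linarith
      finally show "(\<Sum>A\<in>Pow W. subset_weight W (p y) A * exp (c * \<delta> y * of_bool (ev Z y A)))
          \<le> exp (1 / card Y)" .
    qed
    also have "\<dots> = exp 1"
      using cardY by (simp add: exp_of_nat_mult[symmetric])
    finally show ?thesis .
  qed
  \<comment> \<open>One score for all requirements: its summands are nonnegative, so a score below 1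
    bounds each of them by 1. The edge term has expectation 1/4, and the 2^N terms for
    \<open>Z\<close> have expectation at most e^(1-2N) each.\<close>
  define score where
    "score F = edges F / (4 * mean) + (\<Sum>Z\<in>Pow W. exp (c * load Z F) / exp (2 * N))" for F
  have "(\<Sum>F\<in>\<Omega>. wt F * score F)
     = (\<Sum>F\<in>\<Omega>. wt F * edges F) / (4 * mean) + (\<Sum>Z\<in>Pow W. (\<Sum>F\<in>\<Omega>. wt F * exp (c * load Z F)) / exp (2 * N))"
    unfolding score_def distrib_left sum.distrib sum_distrib_left sum_divide_distrib
    by (subst (2) sum.swap) (simp add: mult.assoc)
  also have "\<dots> \<le> mean / (4 * mean) + (\<Sum>Z\<in>Pow W. exp 1 / exp (2 * N))"
    unfolding edges_mean using load_mgf by (intro add_mono order_refl sum_mono divide_right_mono) auto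
  also have "\<dots> = 1/4 + 2 powr N * exp (1 - 2 * N)"
    using mean_pos W by (simp add: card_Pow N_def powr_realpow exp_diff)
  also have "\<dots> \<le> 1/4 + exp (-1)"
  proof -
    have "N * ln 2 \<le> N * 1" using N ln_2_le_1 by (intro mult_left_mono) auto
    then have "2 powr N \<le> exp N" by (simp add: powr_def)
    then have "2 powr N * exp (1 - 2 * N) \<le> exp N * exp (1 - 2 * N)"
      by (intro mult_right_mono) auto
    also have "\<dots> \<le> exp (-1)" using N by (simp add: exp_add[symmetric])
    finally show ?thesis by simp
  qed
  also have "\<dots> < 1"
    using exp_ge_add_one_self[of "1::real"] by (simp add: exp_minus field_simps)
  finally obtain F where F: "F \<in> \<Omega>" "score F < 1"
    using exists_score_less_one[OF wt_sum wt_nonneg] by blast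
  have edges_nonneg: "0 \<le> edges F / (4 * mean)"
    using mean_pos by (simp add: edges_def sum_nonneg)
  have sum_nn: "0 \<le> (\<Sum>Z\<in>Pow W. exp (c * load Z F) / exp (2 * N))" by (intro sum_nonneg) auto
  have "edges F / (4 * mean) \<le> 1" using F(2) sum_nn unfolding score_def by linarith
  then have 1: "edges F \<le> 4 * mean" using mean_pos by simp
  have 2: "load Z F \<le> M" if "Z \<subseteq> W" for Z
  proof -
    have "exp (c * load Z F) / exp (2 * N) \<le> (\<Sum>Z\<in>Pow W. exp (c * load Z F) / exp (2 * N))"
      using W that by (intro member_le_sum) auto
    also have "\<dots> < 1" using F(2) edges_nonneg unfolding score_def by linarith
    finally have "c * load Z F < 2 * N" by simp
    then have "c * load Z F < c * M" using cM(2) unfolding N_def by linarith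
    then show ?thesis using cM(1) by simp
  qed
  have 3: "load Z F = (\<Sum>y | y \<in> Y \<and> thin QQ (p y) (t y) Z (F y). \<delta> y)" for Z
  proof -
    have "load Z F = (\<Sum>y\<in>Y. if thin QQ (p y) (t y) Z (F y) then \<delta> y else 0)"
      unfolding load_def ev_def by (intro sum.cong) auto
    then show ?thesis using Y by (simp add: sum.inter_filter)
  qed
  show ?thesis
    using F(1) 1 2 unfolding 3 edges_def mean_def N_def \<Omega>_def
    by (intro exI[of _ F]) (auto simp: PiE_iff Pi_iff mult.assoc)
qed


section \<open>Shrinking common neighbourhoods over D rounds\<close>

definition common_nbrs :: "'w set \<Rightarrow> (nat \<Rightarrow> 'y \<Rightarrow> 'w set) \<Rightarrow> 'y list \<Rightarrow> 'w set" where
  "common_nbrs W R S = {w \<in> W. \<forall>l<length S. w \<in> R l (S ! l)}"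

lemma common_nbrs_cong:
  "(\<And>l. l < length S \<Longrightarrow> R l = R' l) \<Longrightarrow> common_nbrs W R S = common_nbrs W R' S"
  by (auto simp: common_nbrs_def)

lemma common_nbrs_Nil [simp]: "common_nbrs W R [] = W"
  by (simp add: common_nbrs_def)

lemma common_nbrs_take_Suc:
  "k < length S \<Longrightarrow> common_nbrs W R (take (Suc k) S) = common_nbrs W R (take k S) \<inter> R k (S ! k)"
  by (auto simp: common_nbrs_def less_Suc_eq)

text \<open>Round \<open>k\<close> is drawn after the candidate sets \<open>QQ R k\<close> are
  known; there are at most |Y|^k of them. The value \<open>t k y\<close> is what survives of a
  half-free \<open>W\<close> if each of \<open>k\<close> earlier vertices, of density at least
  \<open>p y\<close>, keeps a quarter of its expected share.\<close>

lemma iterated_rounds: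
  fixes W :: "'w set" and Y :: "'y set" and p \<delta> :: "'y \<Rightarrow> real" and D :: nat
  defines "QQ \<equiv> \<lambda>R k. common_nbrs W R ` {S. set S \<subseteq> Y \<and> length S = k}"
    and "t \<equiv> \<lambda>k y. (p y / 4) ^ k * (card W / 2)"
  assumes W: "finite W" "card W \<ge> 2" and Y: "finite Y"
    and p: "\<And>y. y \<in> Y \<Longrightarrow> 0 < p y \<and> p y \<le> 1"
    and \<delta>: "\<And>y. y \<in> Y \<Longrightarrow> 0 \<le> \<delta> y"
    and small: "\<And>y. y \<in> Y \<Longrightarrow> p y < 1 \<Longrightarrow>
       16 * D * \<delta> y + (D + 1) * ln (card Y) \<le> p y ^ D * card W / (8 * 4 ^ D)"
    and "m \<le> D"
  shows "\<exists>R. \<forall>k<m. (\<forall>y\<in>Y. R k y \<subseteq> W) \<and> (\<Sum>y\<in>Y. real (card (R k y))) \<le> 4 * card W * (\<Sum>y\<in>Y. p y) \<and>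
     (\<forall>Z\<subseteq>W. (\<Sum>y | y \<in> Y \<and> thin (QQ R k) (p y) (t k y) Z (R k y). \<delta> y) \<le> card W / (8 * D))"
  using \<open>m \<le> D\<close>
proof (induction m)
  case (Suc m)
  then obtain R where R: "\<forall>k<m. (\<forall>y\<in>Y. R k y \<subseteq> W) \<and>
     (\<Sum>y\<in>Y. real (card (R k y))) \<le> 4 * card W * (\<Sum>y\<in>Y. p y) \<and>
     (\<forall>Z\<subseteq>W. (\<Sum>y | y \<in> Y \<and> thin (QQ R k) (p y) (t k y) Z (R k y). \<delta> y) \<le> card W / (8 * D))"
    by auto
  have D: "D > 0" "m < D" using Suc.prems by auto
  have QQ_sub: "QQ R m \<subseteq> Pow W" by (auto simp: QQ_def common_nbrs_def)
  have card_QQ: "card (QQ R m) \<le> card Y ^ m"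
    using card_image_le[OF finite_lists_length_eq[OF Y]] card_lists_length_eq[OF Y]
    by (metis QQ_def)
  have "\<exists>F. (\<forall>y\<in>Y. F y \<subseteq> W) \<and> (\<Sum>y\<in>Y. real (card (F y))) \<le> 4 * card W * (\<Sum>y\<in>Y. p y) \<and>
     (\<forall>Z\<subseteq>W. (\<Sum>y | y \<in> Y \<and> thin (QQ R m) (p y) (t m y) Z (F y). \<delta> y) \<le> card W / (8 * D))"
  \<comment> \<open>The load bound |W|/(8D) lets the D rounds sum to |W|/8; then c = 16D gives c M =
    2|W|.\<close>
  proof (rule one_round[OF W Y QQ_sub p \<delta>, where c = "16 * real D"])
    fix y assume y: "y \<in> Y"
    then show "0 < t m y" using p[OF y] W by (simp add: t_def)
    assume py: "p y < 1"
    have cY: "card Y \<ge> 1" using y Y by (simp add: Suc_le_eq card_gt_0_iff) blast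
    \<comment> \<open>The last round is the worst: as p \<le> 1, every exponent m + 1 \<le> D may be
      replaced by D.\<close>
    have pow_p: "p y ^ D \<le> p y ^ Suc m" using p[OF y] D by (intro power_decreasing) auto
    have pow_4: "8 * (4::real) ^ m \<le> 8 * 4 ^ D" using D by (intro mult_left_mono power_increasing) auto
    have "p y ^ D * card W / (8 * 4 ^ D) \<le> p y ^ Suc m * card W / (8 * 4 ^ m)"
      using p[OF y] by (intro frac_le[OF _ mult_right_mono[OF pow_p] _ pow_4]) auto
    also have "\<dots> = p y * t m y / 4" by (simp add: t_def power_divide)
    finally have E: "16 * D * \<delta> y + (D + 1) * ln (card Y) \<le> p y * t m y / 4"
      using small[OF y py] by linarith
    have "real (card (QQ R m)) \<le> real (card Y) ^ m"
      using card_QQ by (metis of_nat_le_iff of_nat_power)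
    also have "\<dots> \<le> real (card Y) ^ D" using cY D by (intro power_increasing) auto
    finally have "card Y * (exp (16 * real D * \<delta> y) * (card (QQ R m) * exp (- (p y * t m y / 4))))
       \<le> card Y * (exp (16 * real D * \<delta> y) * (real (card Y) ^ D * exp (- (p y * t m y / 4))))"
      by (intro mult_left_mono mult_right_mono) auto
    also have "\<dots> = real (card Y) ^ (D + 1) * exp (16 * real D * \<delta> y - p y * t m y / 4)"
      by (simp only: diff_conv_add_uminus exp_add power_add power_one_right mult_ac)
    also have "\<dots> = exp ((D + 1) * ln (card Y)) * exp (16 * real D * \<delta> y - p y * t m y / 4)"
      using cY by (subst exp_of_nat_mult) auto
    also have "\<dots> = exp ((D + 1) * ln (card Y) + (16 * real D * \<delta> y - p y * t m y / 4))"
      by (simp only: exp_add)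
    also have "\<dots> \<le> exp 0" unfolding exp_le_cancel_iff using E by simp
    also have "\<dots> = 1" by simp
    finally show "card Y * (exp (16 * real D * \<delta> y) * (card (QQ R m) * exp (- (p y * t m y / 4)))) \<le> 1" .
  qed (use D in auto)
  then obtain F where F: "(\<forall>y\<in>Y. F y \<subseteq> W) \<and> (\<Sum>y\<in>Y. real (card (F y))) \<le> 4 * card W * (\<Sum>y\<in>Y. p y) \<and>
     (\<forall>Z\<subseteq>W. (\<Sum>y | y \<in> Y \<and> thin (QQ R m) (p y) (t m y) Z (F y). \<delta> y) \<le> card W / (8 * D))" ..
  \<comment> \<open>Lists of length k \<le> m consult only the relations of rounds below k, so
    adding round \<open>m\<close> does not alter earlier candidate sets.\<close>
  have QQ_upd: "QQ (R(m := F)) k = QQ R k" if "k \<le> m" for k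
    unfolding QQ_def using that by (intro image_cong common_nbrs_cong) auto
  show ?case
  proof (intro exI[of _ "R(m := F)"] allI impI)
    fix k assume "k < Suc m"
    then consider "k = m" | "k < m" by linarith
    then show "(\<forall>y\<in>Y. (R(m := F)) k y \<subseteq> W) \<and>
       (\<Sum>y\<in>Y. real (card ((R(m := F)) k y))) \<le> 4 * card W * (\<Sum>y\<in>Y. p y) \<and>
       (\<forall>Z\<subseteq>W. (\<Sum>y | y \<in> Y \<and> thin (QQ (R(m := F)) k) (p y) (t k y) Z ((R(m := F)) k y). \<delta> y)
          \<le> card W / (8 * D))"
    proof cases
      case 1
      then show ?thesis using F QQ_upd[of m] by simp
    next
      case 2
      then show ?thesis using R QQ_upd[of k] by simp
    qed
  qed
qed simp

lemma sum_UN_le: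
  fixes f :: "'a \<Rightarrow> real" and D :: nat
  assumes "\<And>k. k < D \<Longrightarrow> finite (A k)" "\<And>k x. k < D \<Longrightarrow> x \<in> A k \<Longrightarrow> 0 \<le> f x"
  shows "sum f (\<Union>k<D. A k) \<le> (\<Sum>k<D. sum f (A k))"
  using assms
proof (induction D)
  case (Suc D)
  have "sum f (\<Union>k<Suc D. A k) \<le> sum f (\<Union>k<D. A k) + sum f (A D)"
  proof -
    have "sum f ((\<Union>k<D. A k) \<union> A D) = sum f (\<Union>k<D. A k) + sum f (A D) - sum f ((\<Union>k<D. A k) \<inter> A D)"
      using Suc.prems by (intro sum_Un) auto
    moreover have "0 \<le> sum f ((\<Union>k<D. A k) \<inter> A D)" using Suc.prems by (intro sum_nonneg) auto
    ultimately show ?thesis by (simp add: lessThan_Suc Un_commute)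
  qed
  moreover have "sum f (\<Union>k<D. A k) \<le> (\<Sum>k<D. sum f (A k))"
    using Suc.prems by (intro Suc.IH) (auto simp: less_Suc_eq)
  ultimately show ?case by simp
qed simp

text \<open>If every vertex of \<open>S\<close> avoids the thin ones, each step keeps a positive
  fraction of the free common neighbours, so they cannot all lie in \<open>Z\<close>.\<close>

lemma column_exists:
  fixes W :: "'w set" and Y :: "'y set" and p \<delta> :: "'y \<Rightarrow> real" and D :: nat
  assumes W: "finite W" "card W \<ge> 2" and Y: "finite Y" and D: "D > 0"
    and p: "\<And>y. y \<in> Y \<Longrightarrow> 0 < p y \<and> p y \<le> 1"
    and \<delta>: "\<And>y. y \<in> Y \<Longrightarrow> 0 \<le> \<delta> y"
    and small: "\<And>y. y \<in> Y \<Longrightarrow> p y < 1 \<Longrightarrow>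
       16 * D * \<delta> y + (D + 1) * ln (card Y) \<le> p y ^ D * card W / (8 * 4 ^ D)"
  shows "\<exists>R. (\<Sum>k<D. \<Sum>y\<in>Y. real (card (R k y))) \<le> 4 * D * card W * (\<Sum>y\<in>Y. p y) \<and>
     (\<forall>k<D. \<forall>y\<in>Y. R k y \<subseteq> W) \<and>
     (\<forall>Z\<subseteq>W. 2 * card Z \<le> card W \<longrightarrow> (\<exists>B\<subseteq>Y. sum \<delta> B \<le> card W / 8 \<and>
        (\<forall>S. set S \<subseteq> Y \<and> length S \<le> D \<and> sorted_wrt (\<lambda>a b. p b \<le> p a) S \<and> common_nbrs W R S \<subseteq> Z
           \<longrightarrow> set S \<inter> B \<noteq> {})))"
proof -
  define t where "t k y = (p y / 4) ^ k * (card W / 2)" for k y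
  define QQ where "QQ R k = common_nbrs W R ` {S. set S \<subseteq> Y \<and> length S = k}" for R k
  from iterated_rounds[where p = p and \<delta> = \<delta>, OF W Y p \<delta> small order_refl] obtain R where R': "\<forall>k<D. (\<forall>y\<in>Y. R k y \<subseteq> W) \<and>
     (\<Sum>y\<in>Y. real (card (R k y))) \<le> 4 * card W * (\<Sum>y\<in>Y. p y) \<and>
     (\<forall>Z\<subseteq>W. (\<Sum>y | y \<in> Y \<and> thin (QQ R k) (p y) (t k y) Z (R k y). \<delta> y) \<le> card W / (8 * D))"
    unfolding QQ_def t_def by blast
  then have R: "\<And>k y. k < D \<Longrightarrow> y \<in> Y \<Longrightarrow> R k y \<subseteq> W"
    "\<And>k. k < D \<Longrightarrow> (\<Sum>y\<in>Y. real (card (R k y))) \<le> 4 * card W * (\<Sum>y\<in>Y. p y)"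
    "\<And>k Z. k < D \<Longrightarrow> Z \<subseteq> W \<Longrightarrow>
       (\<Sum>y | y \<in> Y \<and> thin (QQ R k) (p y) (t k y) Z (R k y). \<delta> y) \<le> card W / (8 * D)"
    by blast+
  have "(\<Sum>k<D. \<Sum>y\<in>Y. real (card (R k y))) \<le> (\<Sum>k<D. 4 * card W * (\<Sum>y\<in>Y. p y))"
    using R(2) by (intro sum_mono) auto
  then have edges: "(\<Sum>k<D. \<Sum>y\<in>Y. real (card (R k y))) \<le> 4 * D * card W * (\<Sum>y\<in>Y. p y)"
    by simp
  have "\<exists>B\<subseteq>Y. sum \<delta> B \<le> card W / 8 \<and>
        (\<forall>S. set S \<subseteq> Y \<and> length S \<le> D \<and> sorted_wrt (\<lambda>a b. p b \<le> p a) S \<and> common_nbrs W R S \<subseteq> Z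
           \<longrightarrow> set S \<inter> B \<noteq> {})" if Z: "Z \<subseteq> W" "2 * card Z \<le> card W" for Z
  proof -
    \<comment> \<open>A vertex is exceptional if it is thin in any round, whatever its position in
      the list.\<close>
    define B where "B = (\<Union>k<D. {y \<in> Y. thin (QQ R k) (p y) (t k y) Z (R k y)})"
    have "sum \<delta> B \<le> (\<Sum>k<D. sum \<delta> {y \<in> Y. thin (QQ R k) (p y) (t k y) Z (R k y)})"
      unfolding B_def using Y \<delta> by (intro sum_UN_le) auto
    also have "\<dots> \<le> (\<Sum>k<D. card W / (8 * D))" using R(3) Z by (intro sum_mono) auto
    also have "\<dots> = card W / 8" using D by simp
    finally have "sum \<delta> B \<le> card W / 8" .
    moreover have "set S \<inter> B \<noteq> {}"
      if S: "set S \<subseteq> Y" "length S \<le> D" "sorted_wrt (\<lambda>a b. p b \<le> p a) S" "common_nbrs W R S \<subseteq> Z" for S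
    proof
      assume disj: "set S \<inter> B = {}"
      have pS: "0 < p (S ! l)" if "l < length S" for l using p S that nth_mem by blast
      have "(\<Prod>l<k. p (S ! l) / 4) * (card W / 2) \<le> card (common_nbrs W R (take k S) - Z)"
        if "k \<le> length S" for k
        using that
      proof (induction k)
        case 0
        have "card (W - Z) = card W - card Z" using Z W by (simp add: card_Diff_subset finite_subset)
        then show ?case using Z by simp
      next
        case (Suc k)
        then have k: "k < length S" "k < D" using S by auto
        let ?y = "S ! k" and ?Q = "common_nbrs W R (take k S)"
        have y: "?y \<in> Y" "?y \<in> set S" using S k by auto
        have IH: "(\<Prod>l<k. p (S ! l) / 4) * (card W / 2) \<le> card (?Q - Z)" using Suc by simp
        have "?y \<notin> B" using disj y by auto
        then have nthin: "\<not> thin (QQ R k) (p ?y) (t k ?y) Z (R k ?y)" using y k by (auto simp: B_def)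
        have Q: "?Q \<in> QQ R k" unfolding QQ_def
          using k S(1) set_take_subset[of k S] by (intro imageI) auto
        \<comment> \<open>Here the order of \<open>S\<close> enters: earlier densities are at least
          the current one, so the size required by \<open>thin\<close> is reached.\<close>
        have "(p ?y / 4) ^ k = (\<Prod>l<k. p ?y / 4)" by simp
        also have "\<dots> \<le> (\<Prod>l<k. p (S ! l) / 4)"
          using pS k S(3) by (intro prod_mono) (auto simp: sorted_wrt_iff_nth_less less_imp_le)
        finally have "t k ?y \<le> (\<Prod>l<k. p (S ! l) / 4) * (card W / 2)"
          unfolding t_def by (intro mult_right_mono) auto
        then have "t k ?y \<le> card (?Q - Z)" using IH by linarith
        then have "p ?y / 4 * card (?Q - Z) \<le> card (R k ?y \<inter> (?Q - Z))"
          using nthin Q by (force simp: thin_def not_less)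
        moreover have "R k ?y \<inter> (?Q - Z) = common_nbrs W R (take (Suc k) S) - Z"
          using k by (auto simp: common_nbrs_take_Suc)
        moreover have "p ?y / 4 * ((\<Prod>l<k. p (S ! l) / 4) * (card W / 2)) \<le> p ?y / 4 * card (?Q - Z)"
          using IH pS[OF k(1)] by (intro mult_left_mono) auto
        ultimately show ?case by (simp add: mult_ac)
      qed
      from this[of "length S"] have "(\<Prod>l<length S. p (S ! l) / 4) * (card W / 2) \<le> card (common_nbrs W R S - Z)"
        by simp
      moreover have "common_nbrs W R S - Z = {}" using S(4) by auto
      moreover have "0 < (\<Prod>l<length S. p (S ! l) / 4) * (card W / 2)"
        using pS W by (intro mult_pos_pos prod_pos) auto
      ultimately show False by simp
    qed
    moreover have "B \<subseteq> Y" by (auto simp: B_def)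
    ultimately show ?thesis by blast
  qed
  then show ?thesis using edges R(1) by (intro exI[of _ R]) blast
qed


section \<open>Greedy embedding into a layered host\<close>

text \<open>The order is built from its end: a vertex of degree at most \<open>D\<close> goes last,
  and the rest is still degenerate.\<close>

lemma degeneracy_order:
  assumes "finite V" "degenerate V E D"
  shows "\<exists>xs. distinct xs \<and> set xs = V \<and>
     (\<forall>i<length xs. card {u \<in> set (take i xs). {xs ! i, u} \<in> E} \<le> D)"
  using assms
proof (induction "card V" arbitrary: V)
  case (Suc m)
  then obtain u where u: "u \<in> V" "card {v \<in> V. {u, v} \<in> E} \<le> D"
    unfolding degenerate_def by (metis card.empty order_refl nat.distinct(1))
  have "degenerate (V - {u}) E D" using Suc.prems unfolding degenerate_def by blast
  moreover have "m = card (V - {u})" using Suc.hyps(2) Suc.prems(1) u by simp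
  ultimately obtain xs where xs: "distinct xs" "set xs = V - {u}"
    "\<And>i. i < length xs \<Longrightarrow> card {v \<in> set (take i xs). {xs ! i, v} \<in> E} \<le> D"
    using Suc.hyps(1)[of "V - {u}"] Suc.prems(1) by blast
  have "card {v \<in> V - {u}. {u, v} \<in> E} \<le> card {v \<in> V. {u, v} \<in> E}"
    using Suc.prems(1) by (intro card_mono) auto
  then have "card {v \<in> set (take i (xs @ [u])). {(xs @ [u]) ! i, v} \<in> E} \<le> D"
    if "i < length (xs @ [u])" for i
    using that xs u by (cases "i = length xs") (auto simp: nth_append)
  then show ?case using xs u by (intro exI[of _ "xs @ [u]"]) auto
qed auto

section \<open>The layered vertex set and the greedy invariant\<close>

definition level :: "nat \<Rightarrow> nat \<Rightarrow> (nat \<times> nat) set" where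
  "level h i = {i} \<times> {..<2 ^ (h - i)}"

definition levels :: "nat \<Rightarrow> (nat \<times> nat) set" where
  "levels h = (\<Union>i<h. level h i)"

text \<open>The factor 4D is chosen so that counting edges leaves at most 1/8 of the size of level
  \<open>i\<close> for vertices that start above it.\<close>

definition threshold :: "nat \<Rightarrow> nat \<Rightarrow> nat" where
  "threshold D i = 4 * D * 2 ^ i"

lemma finite_level [simp]: "finite (level h i)"
  and card_level [simp]: "card (level h i) = 2 ^ (h - i)"
  by (simp_all add: level_def)

lemma finite_levels [simp]: "finite (levels h)"
  by (simp add: levels_def)

lemma mem_level_iff: "a \<in> level h i \<longleftrightarrow> fst a = i \<and> snd a < 2 ^ (h - i)"
  by (cases a) (auto simp: level_def)

lemma mem_levels_iff: "a \<in> levels h \<longleftrightarrow> fst a < h \<and> snd a < 2 ^ (h - fst a)"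
  by (auto simp: levels_def mem_level_iff)

text \<open>For every possible set \<open>Z\<close> of occupied vertices of a level there are few exceptional
  vertices \<open>B\<close> such that neighbour lists avoiding \<open>B\<close> have a common neighbour outside \<open>Z\<close>.
  The relation may depend on the position in the list, which runs through decreasing levels.\<close>
locale layered_host =
  fixes D h :: nat and R :: "nat \<Rightarrow> nat \<Rightarrow> nat \<times> nat \<Rightarrow> (nat \<times> nat) set"
  assumes D_pos: "0 < D" and h_pos: "0 < h"
    and few_exceptional: "\<And>i Z. i < h \<Longrightarrow> Z \<subseteq> level h i \<Longrightarrow> 2 * card Z \<le> 2 ^ (h - i) \<Longrightarrow>
      \<exists>B\<subseteq>levels h. 8 * (\<Sum>a\<in>B. threshold D (fst a)) \<le> 2 ^ (h - i) \<and>
        (\<forall>S. set S \<subseteq> levels h \<and> length S \<le> D \<and> sorted_wrt (\<lambda>a b. fst b \<le> fst a) S \<and>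
           common_nbrs (level h i) (R i) S \<subseteq> Z \<longrightarrow> set S \<inter> B \<noteq> {})"
begin

text \<open>A directed relation: \<open>w\<close> hosts the later vertex, and its level selects the
  relation consulted.\<close>

definition adjacent :: "nat \<times> nat \<Rightarrow> nat \<times> nat \<Rightarrow> bool" where
  "adjacent a w \<longleftrightarrow> (\<exists>k<D. w \<in> R (fst w) k a)"

context
  fixes xs :: "'v list" and prior :: "'v \<Rightarrow> 'v set"
  assumes dist: "distinct xs" and len: "2 * length xs \<le> 2 ^ h"
    and prior_sub: "\<And>m. m < length xs \<Longrightarrow> prior (xs ! m) \<subseteq> set (take m xs)"
    and prior_card: "\<And>x. x \<in> set xs \<Longrightarrow> card (prior x) \<le> D"
begin

definition fdeg :: "'v \<Rightarrow> nat" where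
  "fdeg y = card {x \<in> set xs. y \<in> prior x}"

definition start :: "'v \<Rightarrow> nat" where
  "start x = (LEAST i. fdeg x < threshold D i)"

text \<open>Refers to the current occupied set, not to the one at the time \<open>x\<close> was
  embedded. Since it is monotone in \<open>P\<close>, it persists, and one final \<open>Z\<close>
  accounts for all vertices that passed level \<open>i\<close>. The list is existential because
  neighbours in the same level have no canonical order.\<close>

definition blocked :: "('v \<Rightarrow> nat \<times> nat) \<Rightarrow> 'v set \<Rightarrow> nat \<Rightarrow> 'v \<Rightarrow> bool" where
  "blocked f P i x \<longleftrightarrow> (\<exists>S. set S = f ` prior x \<and> length S \<le> D \<and>
     sorted_wrt (\<lambda>a b. fst b \<le> fst a) S \<and> common_nbrs (level h i) (R i) S \<subseteq> f ` P)"

definition partial_embedding :: "'v set \<Rightarrow> ('v \<Rightarrow> nat \<times> nat) \<Rightarrow> bool" where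
  "partial_embedding P f \<longleftrightarrow> inj_on f P \<and> f ` P \<subseteq> levels h \<and>
     (\<forall>x\<in>P. start x \<le> fst (f x) \<and> (\<forall>y\<in>prior x. adjacent (f y) (f x)) \<and>
        (\<forall>i. start x \<le> i \<and> i < fst (f x) \<longrightarrow> blocked f P i x))"

lemma fdeg_le: "fdeg x \<le> length xs"
  unfolding fdeg_def using card_mono[of "set xs" "{y \<in> set xs. x \<in> prior y}"] dist
  by (simp add: distinct_card)

text \<open>Makes the \<open>LEAST\<close> in \<open>start\<close> meaningful: the threshold of the
  last level exceeds the number of vertices.\<close>

lemma fdeg_less_last: "fdeg x < threshold D (h - 1)"
proof -
  have "fdeg x \<le> 2 ^ (h - 1)" using fdeg_le[of x] len h_pos by (cases h) auto
  moreover have "(1::nat) * 2 ^ (h - 1) < (4 * D) * 2 ^ (h - 1)" using D_pos by (intro mult_strict_right_mono) auto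
  ultimately show ?thesis unfolding threshold_def by linarith
qed

lemma fdeg_less: "fdeg x < threshold D (start x)"
  unfolding start_def using fdeg_less_last by (rule LeastI)

lemma fdeg_ge: "i < start x \<Longrightarrow> threshold D i \<le> fdeg x"
  unfolding start_def using not_less_Least not_less by blast

lemma start_le: "start x \<le> h - 1"
  unfolding start_def using fdeg_less_last by (rule Least_le)

text \<open>Double counting: the forward degrees sum to at most D n, while each vertex counted
  contributes at least 4D 2^i.\<close>

lemma few_high_degree:
  assumes "i < h"
  shows "8 * card {x \<in> set xs. i < start x} \<le> 2 ^ (h - i)"
proof -
  have prior_in: "prior x \<subseteq> set xs" if "x \<in> set xs" for x
    using that prior_sub set_take_subset by (metis in_set_conv_nth subset_trans)
  let ?H = "{x \<in> set xs. i < start x}"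
  have "card ?H * threshold D i = (\<Sum>x\<in>?H. threshold D i)" by simp
  also have "\<dots> \<le> (\<Sum>x\<in>?H. fdeg x)" using fdeg_ge by (intro sum_mono) auto
  also have "\<dots> \<le> (\<Sum>x\<in>set xs. fdeg x)" by (intro sum_mono2) auto
  also have "\<dots> = (\<Sum>y\<in>set xs. \<Sum>x\<in>set xs. of_bool (y \<in> prior x))"
    by (intro sum.cong refl) (simp add: fdeg_def Int_def)
  also have "\<dots> = (\<Sum>x\<in>set xs. \<Sum>y\<in>set xs. of_bool (y \<in> prior x))" by (rule sum.swap)
  also have "\<dots> = (\<Sum>x\<in>set xs. card (prior x))"
  proof (intro sum.cong refl)
    fix x assume "x \<in> set xs"
    then have "set xs \<inter> prior x = prior x" using prior_in by auto
    then show "(\<Sum>y\<in>set xs. of_bool (y \<in> prior x)) = card (prior x)" by (simp add: Int_def)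
  qed
  also have "\<dots> \<le> (\<Sum>x\<in>set xs. D)" using prior_card by (intro sum_mono) auto
  also have "\<dots> = D * length xs" using dist by (simp add: distinct_card)
  finally have "D * (card ?H * 4 * 2 ^ i) \<le> D * length xs" by (simp add: threshold_def mult_ac)
  then have "card ?H * 4 * 2 ^ i \<le> length xs" using D_pos by simp
  then have "8 * card ?H * 2 ^ i \<le> 2 ^ h" using len by linarith
  also have "(2::nat) ^ h = 2 ^ (h - i) * 2 ^ i" using assms by (simp flip: power_add)
  finally show ?thesis by simp
qed

context
  fixes P f
  assumes P: "P \<subseteq> set xs" "\<And>x. x \<in> P \<Longrightarrow> prior x \<subseteq> P" and pe: "partial_embedding P f"
begin

lemma inj: "inj_on f P" and img: "f ` P \<subseteq> levels h"
  using pe by (auto simp: partial_embedding_def)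

lemma finite_P: "finite P"
  using P(1) finite_subset by blast

text \<open>A vertex that passed level \<open>i\<close> has an earlier neighbour placed in the
  exceptional set. Such a neighbour has forward degree below the threshold of its start level, hence
  of the level it occupies, so the weight of the exceptional set bounds the count.\<close>

lemma few_passing:
  assumes i: "i < h" and occ: "2 * card (f ` P \<inter> level h i) \<le> 2 ^ (h - i)"
  shows "8 * card {x \<in> P. start x \<le> i \<and> i < fst (f x)} \<le> 2 ^ (h - i)"
proof -
  obtain B where B: "B \<subseteq> levels h" "8 * (\<Sum>a\<in>B. threshold D (fst a)) \<le> 2 ^ (h - i)"
    "\<And>S. set S \<subseteq> levels h \<Longrightarrow> length S \<le> D \<Longrightarrow> sorted_wrt (\<lambda>a b. fst b \<le> fst a) S \<Longrightarrow>
       common_nbrs (level h i) (R i) S \<subseteq> f ` P \<inter> level h i \<Longrightarrow> set S \<inter> B \<noteq> {}"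
    using few_exceptional[OF i _ occ] by blast
  have finB: "finite B" using B(1) finite_subset finite_levels by blast
  let ?A = "{y \<in> P. f y \<in> B}"
  have "{x \<in> P. start x \<le> i \<and> i < fst (f x)} \<subseteq> (\<Union>y\<in>?A. {x \<in> set xs. y \<in> prior x})"
  proof
    fix x assume "x \<in> {x \<in> P. start x \<le> i \<and> i < fst (f x)}"
    then have x: "x \<in> P" "blocked f P i x" using pe by (auto simp: partial_embedding_def)
    then obtain S where S: "set S = f ` prior x" "length S \<le> D"
      "sorted_wrt (\<lambda>a b. fst b \<le> fst a) S" "common_nbrs (level h i) (R i) S \<subseteq> f ` P"
      by (auto simp: blocked_def)
    have "common_nbrs (level h i) (R i) S \<subseteq> f ` P \<inter> level h i"
      using S(4) by (auto simp: common_nbrs_def)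
    moreover have "set S \<subseteq> levels h" using S(1) P(2)[OF x(1)] img by auto
    ultimately have "set S \<inter> B \<noteq> {}" using B(3) S by blast
    then obtain y where "y \<in> prior x" "f y \<in> B" using S(1) by auto
    then show "x \<in> (\<Union>y\<in>?A. {x \<in> set xs. y \<in> prior x})" using x P by blast
  qed
  then have "card {x \<in> P. start x \<le> i \<and> i < fst (f x)} \<le> card (\<Union>y\<in>?A. {x \<in> set xs. y \<in> prior x})"
    using finite_P by (intro card_mono) auto
  also have "\<dots> \<le> (\<Sum>y\<in>?A. fdeg y)" unfolding fdeg_def using finite_P by (intro card_UN_le) auto
  also have "\<dots> \<le> (\<Sum>y\<in>?A. threshold D (fst (f y)))"
  proof (intro sum_mono)
    fix y assume "y \<in> ?A"
    then have "start y \<le> fst (f y)" using pe by (auto simp: partial_embedding_def)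
    then have "threshold D (start y) \<le> threshold D (fst (f y))" by (simp add: threshold_def)
    then show "fdeg y \<le> threshold D (fst (f y))" using fdeg_less[of y] by linarith
  qed
  also have "\<dots> = (\<Sum>a\<in>f ` ?A. threshold D (fst a))"
    using inj by (subst sum.reindex) (auto intro: inj_on_subset)
  also have "\<dots> \<le> (\<Sum>a\<in>B. threshold D (fst a))" using finB by (intro sum_mono2) auto
  finally show ?thesis using B(2) by linarith
qed

lemma occupied_eq: "i < h \<Longrightarrow> card (f ` P \<inter> level h i) = card {x \<in> P. fst (f x) = i}"
proof -
  have "f ` P \<inter> level h i = f ` {x \<in> P. fst (f x) = i}"
    using img by (auto simp: mem_level_iff mem_levels_iff)
  then show ?thesis using inj by (simp add: card_image inj_on_subset)
qed

text \<open>Induction, since \<open>few_passing\<close> at level \<open>i\<close> needs that level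
  half free. An occupant of the next level either starts above \<open>i\<close> or passed
  \<open>i\<close>; together these are 1/8 + 1/8 of level \<open>i\<close>, which is half of level i
  + 1.\<close>

lemma half_free: "i < h \<Longrightarrow> 2 * card (f ` P \<inter> level h i) \<le> 2 ^ (h - i)"
proof (induction i)
  case 0
  have "card {x \<in> P. fst (f x) = 0} \<le> card (set xs)" using P(1) by (intro card_mono) auto
  then show ?case using occupied_eq[OF 0] len dist by (simp add: distinct_card)
next
  case (Suc i)
  have i: "i < h" using Suc by simp
  have "{x \<in> P. fst (f x) = Suc i} \<subseteq> {x \<in> set xs. i < start x} \<union> {x \<in> P. start x \<le> i \<and> i < fst (f x)}"
    using P(1) by auto
  then have "card {x \<in> P. fst (f x) = Suc i} \<le>
      card ({x \<in> set xs. i < start x} \<union> {x \<in> P. start x \<le> i \<and> i < fst (f x)})"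
    using finite_P by (intro card_mono) auto
  also have "\<dots> \<le> card {x \<in> set xs. i < start x} + card {x \<in> P. start x \<le> i \<and> i < fst (f x)}"
    by (rule card_Un_le)
  finally have "4 * card {x \<in> P. fst (f x) = Suc i} \<le> 2 ^ (h - i)"
    using few_high_degree[OF i] few_passing[OF i Suc.IH[OF i]] by linarith
  moreover have "(2::nat) ^ (h - i) = 2 * 2 ^ (h - Suc i)"
    using Suc.prems by (simp add: Suc_diff_Suc flip: power_Suc)
  ultimately show ?case using occupied_eq[OF Suc.prems] by simp
qed

lemma extend:
  assumes x: "x \<in> set xs" "x \<notin> P" "prior x \<subseteq> P"
  shows "\<exists>f'. partial_embedding (insert x P) f'"
proof -
  have fin_prior: "finite (prior x)" using x finite_P finite_subset by blast
  then obtain S0 where S0: "set S0 = f ` prior x" "distinct S0"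
    using finite_distinct_list by (metis finite_imageI)
  define S where "S = rev (sort_key fst S0)"
  have S: "set S = f ` prior x" "sorted_wrt (\<lambda>a b. fst b \<le> fst a) S"
    using sorted_sort_key[of fst S0] S0 by (auto simp: S_def sorted_wrt_rev sorted_map)
  have "length S = card (f ` prior x)" using S0 by (metis S_def distinct_card length_rev length_sort)
  then have lenS: "length S \<le> D" using card_image_le[OF fin_prior, of f] prior_card[OF x(1)] by linarith
  have S_sub: "set S \<subseteq> levels h" using S(1) x(3) img by auto
  let ?free = "\<lambda>i. start x \<le> i \<and> \<not> common_nbrs (level h i) (R i) S \<subseteq> f ` P"
  have last: "?free (h - 1)"
  proof
    have "h - 1 < h" using h_pos by simp
    then obtain B where B: "B \<subseteq> levels h" "8 * (\<Sum>a\<in>B. threshold D (fst a)) \<le> 2 ^ (h - (h - 1))"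
      "\<And>S. set S \<subseteq> levels h \<Longrightarrow> length S \<le> D \<Longrightarrow> sorted_wrt (\<lambda>a b. fst b \<le> fst a) S \<Longrightarrow>
         common_nbrs (level h (h - 1)) (R (h - 1)) S \<subseteq> f ` P \<inter> level h (h - 1) \<Longrightarrow> set S \<inter> B \<noteq> {}"
      using few_exceptional[OF _ _ half_free] by (metis inf_le2)
    \<comment> \<open>The last level has two vertices, so 8 times the weight of \<open>B\<close> is
      at most 2 and \<open>B\<close> is empty: the greedy procedure never runs out of
      levels.\<close>
    have "(\<Sum>a\<in>B. threshold D (fst a)) = 0" using B(2) h_pos by (cases h) auto
    moreover have "finite B" using B(1) finite_subset finite_levels by blast
    ultimately have "B = {}" using D_pos by (auto simp: threshold_def)
    then have "\<not> common_nbrs (level h (h - 1)) (R (h - 1)) S \<subseteq> f ` P \<inter> level h (h - 1)"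
      using B(3)[OF S_sub lenS S(2)] by auto
    then show "\<not> common_nbrs (level h (h - 1)) (R (h - 1)) S \<subseteq> f ` P"
      by (auto simp: common_nbrs_def)
  qed (rule start_le)
  define i where "i = (LEAST i. ?free i)"
  have i: "?free i" unfolding i_def using last by (rule LeastI)
  have i_less: "i < h" using Least_le[of ?free, OF last] h_pos unfolding i_def by linarith
  have before: "common_nbrs (level h j) (R j) S \<subseteq> f ` P" if "start x \<le> j" "j < i" for j
    using not_less_Least[of j ?free] that unfolding i_def by auto
  obtain w where w: "w \<in> common_nbrs (level h i) (R i) S" "w \<notin> f ` P" using i by auto
  define f' where "f' = f(x := w)"
  have w_level: "fst w = i" "w \<in> levels h"
    using w(1) i_less by (auto simp: common_nbrs_def mem_level_iff mem_levels_iff)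
  have agree: "f' y = f y" if "y \<in> P" for y using that x by (auto simp: f'_def)
  have prior_image: "f' ` prior z = f ` prior z" if "z \<in> insert x P" for z
    using that x P(2) agree by (intro image_cong) auto
  have grow: "f ` P \<subseteq> f' ` insert x P" using agree by force
  \<comment> \<open>The images of earlier neighbours are unchanged and the occupied set only
    grows.\<close>
  have block: "blocked f' (insert x P) j z" if "blocked f P j z" "z \<in> insert x P" for j z
    using that prior_image[OF that(2)] grow unfolding blocked_def by (metis subset_trans)
  have "partial_embedding (insert x P) f'"
    unfolding partial_embedding_def
  proof (intro conjI ballI allI impI)
    show "inj_on f' (insert x P)"
      using inj w x agree by (auto simp: inj_on_insert f'_def inj_on_fun_updI)
    show "f' ` insert x P \<subseteq> levels h" using img w_level agree by (auto simp: f'_def)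
  next
    fix z assume z: "z \<in> insert x P"
    show "start z \<le> fst (f' z)"
      using z i w_level pe agree by (cases "z = x") (auto simp: f'_def partial_embedding_def)
    fix y assume y: "y \<in> prior z"
    show "adjacent (f' y) (f' z)"
    proof (cases "z = x")
      case True
      then have "f y \<in> set S" "f' y = f y" using y S(1) x(3) agree by auto
      then obtain l where l: "l < length S" "S ! l = f' y" by (metis in_set_conv_nth)
      then have "w \<in> R i l (f' y)" using w(1) by (auto simp: common_nbrs_def)
      moreover have "f' z = w" "l < D" using True l lenS by (simp_all add: f'_def)
      ultimately show ?thesis unfolding adjacent_def using w_level(1) by auto
    next
      case False
      then show ?thesis using z y pe agree P(2)[of z] by (auto simp: partial_embedding_def)
    qed
  next
    fix z j assume z: "z \<in> insert x P" and j: "start z \<le> j \<and> j < fst (f' z)"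
    have "blocked f P j z"
    proof (cases "z = x")
      case True
      then have "j < i" using j w_level by (simp add: f'_def)
      then show ?thesis using True before S lenS j unfolding blocked_def by blast
    next
      case False
      then show ?thesis using z j pe agree by (auto simp: partial_embedding_def)
    qed
    then show "blocked f' (insert x P) j z" using block z by blast
  qed
  then show ?thesis by blast
qed

end

lemma embedding_exists:
  "\<exists>f. inj_on f (set xs) \<and> f ` set xs \<subseteq> levels h \<and> (\<forall>x\<in>set xs. \<forall>y\<in>prior x. adjacent (f y) (f x))"
proof -
  have prior_closed: "prior x \<subseteq> set (take m xs)" if x: "x \<in> set (take m xs)" for x m
  proof -
    obtain k where k: "k < m" "k < length xs" "x = xs ! k"
      using x by (auto simp: in_set_conv_nth)
    then have "prior x \<subseteq> set (take k xs)" using prior_sub by blast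
    also have "\<dots> \<subseteq> set (take m xs)" using k by (intro set_take_subset_set_take) simp
    finally show ?thesis .
  qed
  have "\<exists>f. partial_embedding (set (take m xs)) f" if "m \<le> length xs" for m
    using that
  proof (induction m)
    case 0
    show ?case by (simp add: partial_embedding_def)
  next
    case (Suc m)
    then obtain f where f: "partial_embedding (set (take m xs)) f" by auto
    have m: "m < length xs" using Suc by simp
    have "xs ! m \<notin> set (take m xs)"
      using dist m by (auto simp: in_set_conv_nth nth_eq_iff_index_eq)
    then have "\<exists>f'. partial_embedding (insert (xs ! m) (set (take m xs))) f'"
      using extend[OF set_take_subset prior_closed f] m prior_sub by auto
    then show ?case using m by (simp add: take_Suc_conv_app_nth)
  qed
  from this[of "length xs"] show ?thesis unfolding partial_embedding_def by auto
qed

end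

end


section \<open>Construction of the host and its number of edges\<close>

text \<open>Below the cap this solves density^D 2^(h-i) / (8 * 4^D) = 16 D (threshold + h), the
  smallness condition of \<open>column_exists\<close> with its logarithmic term bounded by 16 D
  h.\<close>

definition density :: "nat \<Rightarrow> nat \<Rightarrow> nat \<Rightarrow> nat \<Rightarrow> real" where
  "density D h i j =
     min 1 ((128 * real D * 4 ^ D * real (threshold D j + h) / 2 ^ (h - i)) powr (1 / D))"

lemma card_levels_le: "card (levels h) \<le> 2 ^ (2 * h)"
proof -
  have "card (levels h) \<le> (\<Sum>i<h. card (level h i))"
    unfolding levels_def by (intro card_UN_le) simp
  also have "\<dots> \<le> (\<Sum>i<h. 2 ^ h)" unfolding card_level by (intro sum_mono power_increasing) auto
  also have "\<dots> \<le> 2 ^ h * 2 ^ h" using less_exp[of h] by simp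
  finally show ?thesis by (simp add: mult_2 power_add)
qed

lemma density_bounds:
  assumes "D > 0" "h > 0"
  shows "0 < density D h i j \<and> density D h i j \<le> 1"
  using assms by (auto simp: density_def)

lemma density_mono:
  assumes "j \<le> j'"
  shows "density D h i j \<le> density D h i j'"
proof -
  have "threshold D j \<le> threshold D j'" using assms by (simp add: threshold_def)
  then have "real (threshold D j + h) \<le> real (threshold D j' + h)" by simp
  note mult_left_mono[OF this, of "128 * real D * 4 ^ D"]
  then show ?thesis
    unfolding density_def by (intro min.mono order_refl powr_mono2 divide_right_mono) auto
qed

lemma density_strength:
  assumes D: "D > 0" and h: "h > 0" and less: "density D h i j < 1"
  shows "16 * D * threshold D j + (D + 1) * ln (card (levels h))
     \<le> density D h i j ^ D * 2 ^ (h - i) / (8 * 4 ^ D)"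
proof -
  have "ln (card (levels h)) \<le> 2 * h"
  proof (cases "card (levels h) = 0")
    case False
    then have "0 < real (card (levels h))" by (simp add: card_gt_0_iff)
    moreover have "real (card (levels h)) \<le> 2 ^ (2 * h)"
      using card_levels_le[of h] by (metis of_nat_le_iff of_nat_numeral of_nat_power)
    ultimately have "ln (card (levels h)) \<le> ln (2 ^ (2 * h))" by (subst ln_le_cancel_iff) auto
    also have "\<dots> = real (2 * h) * ln 2" by (simp add: ln_realpow)
    also have "\<dots> \<le> real (2 * h) * 1" using ln_2_le_1 by (intro mult_left_mono) auto
    finally show ?thesis by simp
  qed simp
  then have "real (D + 1) * ln (card (levels h)) \<le> real (D + 1) * real (2 * h)"
    by (intro mult_left_mono) auto
  also have "\<dots> = real ((D + 1) * (2 * h))" by (simp only: of_nat_mult)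
  \<comment> \<open>A generous 8D for D + 1, so that both terms carry the same factor 16 D.\<close>
  also have "\<dots> \<le> real ((8 * D) * (2 * h))" using D by (intro of_nat_mono mult_right_mono) auto
  finally have "real (D + 1) * ln (card (levels h)) \<le> 16 * real D * real h" by simp
  then have A: "16 * D * threshold D j + (D + 1) * ln (card (levels h)) \<le> 16 * real D * real (threshold D j + h)"
    unfolding of_nat_add distrib_left by simp
  let ?x = "128 * real D * 4 ^ D * real (threshold D j + h) / 2 ^ (h - i)"
  have x: "?x > 0" using D h by simp
  have "density D h i j = ?x powr (1 / D)" using less by (auto simp: density_def min_def split: if_splits)
  moreover have "(x powr (1 / real D)) ^ D = x" if "x > 0" for x :: real
    using that D by (simp add: powr_power)
  ultimately have "density D h i j ^ D = ?x" using x by metis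
  then have "density D h i j ^ D * 2 ^ (h - i) / (8 * 4 ^ D) = 16 * real D * real (threshold D j + h)"
    by simp
  then show ?thesis using A unfolding of_nat_add of_nat_1 by linarith
qed

lemma host_exists:
  assumes D: "D > 0" and h: "h > 0"
  shows "\<exists>R. layered_host D h R \<and> (\<forall>i<h. \<forall>k<D. \<forall>a\<in>levels h. R i k a \<subseteq> level h i) \<and>
     (\<forall>i<h. (\<Sum>k<D. \<Sum>a\<in>levels h. real (card (R i k a)))
        \<le> 4 * real D * 2 ^ (h - i) * (\<Sum>a\<in>levels h. density D h i (fst a)))"
proof -
  let ?good = "\<lambda>i R. (\<Sum>k<D. \<Sum>a\<in>levels h. real (card (R k a)))
        \<le> 4 * real D * 2 ^ (h - i) * (\<Sum>a\<in>levels h. density D h i (fst a)) \<and>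
     (\<forall>k<D. \<forall>a\<in>levels h. R k a \<subseteq> level h i) \<and>
     (\<forall>Z\<subseteq>level h i. 2 * card Z \<le> 2 ^ (h - i) \<longrightarrow>
        (\<exists>B\<subseteq>levels h. (\<Sum>a\<in>B. real (threshold D (fst a))) \<le> 2 ^ (h - i) / 8 \<and>
        (\<forall>S. set S \<subseteq> levels h \<and> length S \<le> D \<and>
           sorted_wrt (\<lambda>a b. density D h i (fst b) \<le> density D h i (fst a)) S \<and>
           common_nbrs (level h i) R S \<subseteq> Z \<longrightarrow> set S \<inter> B \<noteq> {})))"
  have "\<exists>R. ?good i R" if i: "i < h" for i
  proof -
    have "(2::nat) ^ 1 \<le> 2 ^ (h - i)" using i by (intro power_increasing) auto
    then have "card (level h i) \<ge> 2" by simp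
    from column_exists[where W = "level h i" and Y = "levels h" and p = "\<lambda>a. density D h i (fst a)"
        and \<delta> = "\<lambda>a. real (threshold D (fst a))" and D = D, OF _ this _ D]
    show ?thesis using density_bounds[OF D h] density_strength[OF D h] by (simp add: add.commute)
  qed
  define R where "R i = (SOME R. ?good i R)" for i
  have R: "?good i (R i)" if "i < h" for i
    unfolding R_def using \<open>\<And>i. i < h \<Longrightarrow> \<exists>R. ?good i R\<close>[OF that] by (rule someI_ex)
  have "layered_host D h R"
  proof
    fix i Z assume i: "i < h" and Z: "Z \<subseteq> level h i" "2 * card Z \<le> 2 ^ (h - i)"
    obtain B where "B \<subseteq> levels h \<and> (\<Sum>a\<in>B. real (threshold D (fst a))) \<le> 2 ^ (h - i) / 8 \<and>
        (\<forall>S. set S \<subseteq> levels h \<and> length S \<le> D \<and>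
           sorted_wrt (\<lambda>a b. density D h i (fst b) \<le> density D h i (fst a)) S \<and>
           common_nbrs (level h i) (R i) S \<subseteq> Z \<longrightarrow> set S \<inter> B \<noteq> {})"
      using conjunct2[OF conjunct2[OF R[OF i]], THEN spec, THEN mp, THEN mp, OF Z] ..
    then have B: "B \<subseteq> levels h" "(\<Sum>a\<in>B. real (threshold D (fst a))) \<le> 2 ^ (h - i) / 8"
      "\<And>S. set S \<subseteq> levels h \<Longrightarrow> length S \<le> D \<Longrightarrow>
           sorted_wrt (\<lambda>a b. density D h i (fst b) \<le> density D h i (fst a)) S \<Longrightarrow>
           common_nbrs (level h i) (R i) S \<subseteq> Z \<Longrightarrow> set S \<inter> B \<noteq> {}"
      by simp_all
    have "real (8 * (\<Sum>a\<in>B. threshold D (fst a))) \<le> real (2 ^ (h - i))" using B(2) by simp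
    then have "8 * (\<Sum>a\<in>B. threshold D (fst a)) \<le> 2 ^ (h - i)" by (simp only: of_nat_le_iff)
    moreover have "set S \<inter> B \<noteq> {}"
      if "set S \<subseteq> levels h" "length S \<le> D" "sorted_wrt (\<lambda>a b. fst b \<le> fst a) S"
        "common_nbrs (level h i) (R i) S \<subseteq> Z" for S
    proof (rule B(3))
      show "sorted_wrt (\<lambda>a b. density D h i (fst b) \<le> density D h i (fst a)) S"
        \<comment> \<open>Density increases with the level, so a list with decreasing levels has
          decreasing densities for every target level at once.\<close>
        using that(3) by (rule sorted_wrt_mono_rel[rotated]) (simp add: density_mono)
    qed (use that in auto)
    ultimately show "\<exists>B\<subseteq>levels h. 8 * (\<Sum>a\<in>B. threshold D (fst a)) \<le> 2 ^ (h - i) \<and>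
        (\<forall>S. set S \<subseteq> levels h \<and> length S \<le> D \<and> sorted_wrt (\<lambda>a b. fst b \<le> fst a) S \<and>
           common_nbrs (level h i) (R i) S \<subseteq> Z \<longrightarrow> set S \<inter> B \<noteq> {})"
      using B(1) by blast
  qed (use D h in auto)
  then show ?thesis using R by (intro exI[of _ R]) simp
qed

section \<open>The host as a universal simple graph\<close>

context layered_host
begin

definition host_edges :: "(nat \<times> nat) set set" where
  "host_edges = {{a, w} | a w. a \<in> levels h \<and> w \<in> levels h \<and> a \<noteq> w \<and> adjacent a w}"

lemma simple_graph_host: "simple_graph (levels h) host_edges"
  by (auto simp: simple_graph_def host_edges_def)

lemma card_host_edges:
  assumes "\<And>i k a. i < h \<Longrightarrow> k < D \<Longrightarrow> a \<in> levels h \<Longrightarrow> R i k a \<subseteq> level h i"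
  shows "card host_edges \<le> (\<Sum>i<h. \<Sum>k<D. \<Sum>a\<in>levels h. card (R i k a))"
proof -
  have finR: "finite (R i k a)" if "i < h" "k < D" "a \<in> levels h" for i k a
    using assms[OF that] finite_subset finite_level by blast
  have "host_edges \<subseteq> (\<Union>i<h. \<Union>k<D. \<Union>a\<in>levels h. (\<lambda>w. {a, w}) ` R i k a)"
    by (force simp: host_edges_def adjacent_def mem_levels_iff)
  then have "card host_edges \<le> card (\<Union>i<h. \<Union>k<D. \<Union>a\<in>levels h. (\<lambda>w. {a, w}) ` R i k a)"
    using finR by (intro card_mono) auto
  also have "\<dots> \<le> (\<Sum>i<h. card (\<Union>k<D. \<Union>a\<in>levels h. (\<lambda>w. {a, w}) ` R i k a))"
    by (intro card_UN_le) auto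
  also have "\<dots> \<le> (\<Sum>i<h. \<Sum>k<D. card (\<Union>a\<in>levels h. (\<lambda>w. {a, w}) ` R i k a))"
    by (intro sum_mono card_UN_le) auto
  also have "\<dots> \<le> (\<Sum>i<h. \<Sum>k<D. \<Sum>a\<in>levels h. card ((\<lambda>w. {a, w}) ` R i k a))"
    by (intro sum_mono card_UN_le) auto
  also have "\<dots> \<le> (\<Sum>i<h. \<Sum>k<D. \<Sum>a\<in>levels h. card (R i k a))"
    using finR by (intro sum_mono card_image_le) auto
  finally show ?thesis .
qed

lemma universal_host:
  assumes n: "2 * n \<le> 2 ^ h"
  shows "universal n D (levels h) host_edges"
  unfolding universal_def
proof (intro allI impI, elim conjE)
  fix EH assume EH: "simple_graph {0..<n} EH" "degenerate {0..<n} EH D"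
  obtain xs where xs: "distinct xs" "set xs = {0..<n}"
    "\<And>i. i < length xs \<Longrightarrow> card {u \<in> set (take i xs). {xs ! i, u} \<in> EH} \<le> D"
    using degeneracy_order[OF _ EH(2)] by auto
  define prior where
    "prior x = {u. \<exists>i<length xs. x = xs ! i \<and> u \<in> set (take i xs) \<and> {x, u} \<in> EH}" for x
  have prior_nth: "prior (xs ! i) = {u \<in> set (take i xs). {xs ! i, u} \<in> EH}" if "i < length xs" for i
    using that xs(1) by (auto simp: prior_def nth_eq_iff_index_eq)
  have "length xs = n" using xs(1,2) distinct_card by fastforce
  then have "\<exists>f. inj_on f (set xs) \<and> f ` set xs \<subseteq> levels h \<and> (\<forall>x\<in>set xs. \<forall>y\<in>prior x. adjacent (f y) (f x))"
  proof (intro embedding_exists)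
    fix x assume "x \<in> set xs"
    then show "card (prior x) \<le> D" using xs(3) prior_nth by (metis in_set_conv_nth)
  qed (use xs(1) n prior_nth in auto)
  then obtain f where f: "inj_on f (set xs)" "f ` set xs \<subseteq> levels h"
    "\<And>x y. x \<in> set xs \<Longrightarrow> y \<in> prior x \<Longrightarrow> adjacent (f y) (f x)"
    by blast
  have edge: "f ` {xs ! i, xs ! j} \<in> host_edges"
    if "i < j" "j < length xs" "{xs ! j, xs ! i} \<in> EH" for i j
  proof -
    have "xs ! i \<in> set (take j xs)" using that by (auto simp: in_set_conv_nth)
    then have "adjacent (f (xs ! i)) (f (xs ! j))"
      using f(3)[of "xs ! j" "xs ! i"] prior_nth[of j] that by simp
    moreover have "xs ! i \<noteq> xs ! j" using xs(1) that by (simp add: nth_eq_iff_index_eq)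
    then have "f (xs ! i) \<noteq> f (xs ! j)" using f(1) that by (simp add: inj_on_eq_iff)
    moreover have "f (xs ! i) \<in> levels h" "f (xs ! j) \<in> levels h"
      using f(2) that by (auto simp: image_subset_iff)
    ultimately show ?thesis unfolding host_edges_def image_insert image_empty by blast
  qed
  have "f ` e \<in> host_edges" if e: "e \<in> EH" for e
  proof -
    have "card e = 2" "e \<subseteq> set xs" using EH(1) e xs(2) by (auto simp: simple_graph_def)
    then obtain u v where uv: "e = {u, v}" "u \<noteq> v" "u \<in> set xs" "v \<in> set xs"
      by (auto simp: card_2_iff)
    then obtain i j where ij: "i < length xs" "u = xs ! i" "j < length xs" "v = xs ! j"
      by (metis in_set_conv_nth)
    then have "i \<noteq> j" using uv by auto
    then show ?thesis
      using edge[of i j] edge[of j i] ij uv(1) e by (cases "i < j") (auto simp: insert_commute)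
  qed
  then show "contains_subgraph (levels h) host_edges {0..<n} EH"
    unfolding contains_subgraph_def using f xs(2) by (intro exI[of _ f]) auto
qed

end

text \<open>Carries the host from pairs to natural numbers, the vertex type required by the
  theorem.\<close>

lemma transfer_universal:
  assumes "simple_graph V E" "universal n D V E" "inj_on g V"
  shows "simple_graph (g ` V) ((`) g ` E)" "universal n D (g ` V) ((`) g ` E)"
    "card ((`) g ` E) \<le> card E"
proof -
  have E: "e \<subseteq> V" "card e = 2" if "e \<in> E" for e using assms(1) that by (auto simp: simple_graph_def)
  show "simple_graph (g ` V) ((`) g ` E)"
    using assms(1) E card_image[OF inj_on_subset[OF assms(3)]] unfolding simple_graph_def by auto
  have "finite E" using assms(1) finite_subset[of E "Pow V"] by (auto simp: simple_graph_def)
  then show "card ((`) g ` E) \<le> card E" by (rule card_image_le)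
  show "universal n D (g ` V) ((`) g ` E)"
    unfolding universal_def
  proof (intro allI impI)
    fix EH assume "simple_graph {0..<n} EH \<and> degenerate {0..<n} EH D"
    then obtain f where f: "inj_on f {0..<n}" "f ` {0..<n} \<subseteq> V" "\<forall>e\<in>EH. f ` e \<in> E"
      using assms(2) unfolding universal_def contains_subgraph_def by blast
    have "inj_on (g \<circ> f) {0..<n}" using f assms(3) by (intro comp_inj_on) (auto intro: inj_on_subset)
    moreover have "(g \<circ> f) ` e \<in> (`) g ` E" if "e \<in> EH" for e
      using f(3) that by (metis image_comp image_eqI)
    moreover have "(g \<circ> f) ` {0..<n} \<subseteq> g ` V" using f(2) by auto
    ultimately show "contains_subgraph (g ` V) ((`) g ` E) {0..<n} EH"
      unfolding contains_subgraph_def by blast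
  qed
qed

lemma universal_graph_exists:
  assumes D: "D > 0" and h: "h > 0" and n: "2 * n \<le> 2 ^ h"
  shows "\<exists>(V::nat set) E. simple_graph V E \<and> universal n D V E \<and>
    real (card E) \<le> (\<Sum>i<h. 4 * real D * 2 ^ (h - i) * (\<Sum>a\<in>levels h. density D h i (fst a)))"
proof -
  obtain R where host: "layered_host D h R \<and> (\<forall>i<h. \<forall>k<D. \<forall>a\<in>levels h. R i k a \<subseteq> level h i) \<and>
     (\<forall>i<h. (\<Sum>k<D. \<Sum>a\<in>levels h. real (card (R i k a)))
        \<le> 4 * real D * 2 ^ (h - i) * (\<Sum>a\<in>levels h. density D h i (fst a)))"
    using host_exists[OF D h] ..
  then have R: "layered_host D h R"
    "\<And>i k a. i < h \<Longrightarrow> k < D \<Longrightarrow> a \<in> levels h \<Longrightarrow> R i k a \<subseteq> level h i"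
    "\<And>i. i < h \<Longrightarrow> (\<Sum>k<D. \<Sum>a\<in>levels h. real (card (R i k a)))
        \<le> 4 * real D * 2 ^ (h - i) * (\<Sum>a\<in>levels h. density D h i (fst a))"
    by simp_all
  interpret layered_host D h R by fact
  let ?E = "(`) prod_encode ` host_edges"
  have inj: "inj_on prod_encode (levels h)" by (simp add: inj_prod_encode)
  note tr = transfer_universal[OF simple_graph_host universal_host[OF n] inj]
  have "card ?E \<le> (\<Sum>i<h. \<Sum>k<D. \<Sum>a\<in>levels h. card (R i k a))"
    using tr(3) card_host_edges[OF R(2)] by linarith
  then have "real (card ?E) \<le> real (\<Sum>i<h. \<Sum>k<D. \<Sum>a\<in>levels h. card (R i k a))"
    by (simp only: of_nat_le_iff)
  also have "\<dots> = (\<Sum>i<h. \<Sum>k<D. \<Sum>a\<in>levels h. real (card (R i k a)))" by simp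
  also have "\<dots> \<le> (\<Sum>i<h. 4 * real D * 2 ^ (h - i) * (\<Sum>a\<in>levels h. density D h i (fst a)))"
    using R(3) by (intro sum_mono) auto
  finally show ?thesis using tr by blast
qed

section \<open>Summing the densities over pairs of levels\<close>

lemma sum_levels: "(\<Sum>a\<in>levels h. g (fst a)) = (\<Sum>j<h. 2 ^ (h - j) * (g j :: real))"
proof -
  have "(\<Sum>a\<in>levels h. g (fst a)) = (\<Sum>j<h. \<Sum>a\<in>level h j. g (fst a))"
    unfolding levels_def by (subst sum.UNION_disjoint) (auto simp: level_def)
  also have "\<dots> = (\<Sum>j<h. \<Sum>a\<in>level h j. g j)"
    by (intro sum.cong refl) (auto simp: mem_level_iff)
  finally show ?thesis by simp
qed

text \<open>For \<open>D = 1\<close> the ratio is \<open>1\<close> and the sum is \<open>h\<close>, for \<open>D \<ge> 2\<close> it is bounded: this is where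
  the proof treats trees and larger degeneracy at the same time.\<close>
lemma sum_geometric_le:
  fixes D h :: nat
  assumes D: "D > 0" and h: "h > 0"
  shows "(\<Sum>j<h. (2 powr (1 / D - 1)) ^ j) \<le> 4 * real h powr (1 / D)"
proof (cases "D = 1")
  case True
  then show ?thesis using h by simp
next
  case False
  then have "2 \<le> real D" using D by simp
  then have "1 / real D \<le> 1 / 2" by (simp add: divide_simps)
  then have "1 / real D - 1 \<le> - (1 / 2)" by linarith
  then have "2 powr (1 / real D - 1) \<le> (2::real) powr (- (1 / 2))" by (rule powr_mono) simp
  also have "(2::real) powr (- (1 / 2)) = inverse (sqrt 2)"
    by (subst powr_minus, subst powr_half_sqrt) simp_all
  also have "inverse (sqrt 2) \<le> inverse (4 / 3)"
    by (intro le_imp_inverse_le real_le_rsqrt) (simp_all add: power2_eq_square)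
  also have "inverse (4 / 3) = (3 / 4 :: real)" by simp
  finally have "(\<Sum>j<h. (2 powr (1 / D - 1)) ^ j) \<le> (\<Sum>j<h. (3 / 4 :: real) ^ j)"
    by (intro sum_mono power_mono) auto
  also have "\<dots> \<le> (\<Sum>j. (3 / 4 :: real) ^ j)"
    by (intro sum_le_suminf summable_geometric) auto
  also have "\<dots> = 4 * 1" by (simp add: suminf_geometric)
  also have "\<dots> \<le> 4 * real h powr (1 / D)" using h by (intro mult_left_mono ge_one_powr_ge_zero) auto
  finally show ?thesis .
qed

lemma powr_le_self: "1 \<le> x \<Longrightarrow> 0 \<le> e \<Longrightarrow> e \<le> 1 \<Longrightarrow> x powr e \<le> (x::real)"
  using powr_mono[of e 1 x] by simp

text \<open>After the density is split into powers, the double sum over target levels i and source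
  levels j factors. The sum over i gives (2^h)^(1-e) times at most 4 h^e, the sum over j gives 2^h
  times at most 6 h^e, which together make the exponents 2 - e and 2e.\<close>

lemma sum_density_le:
  fixes D h :: nat
  assumes D: "D > 0" and h: "h > 0"
  defines "e \<equiv> 1 / real D"
  shows "(\<Sum>i<h. 4 * real D * 2 ^ (h - i) * (\<Sum>a\<in>levels h. density D h i (fst a)))
     \<le> 98304 * real D ^ 3 * 4 ^ D * (2 powr real h) powr (2 - e) * real h powr (2 * e)"
proof -
  have e: "0 < e" "e \<le> 1" using D by (auto simp: e_def)
  define K where "K = 1024 * real D ^ 2 * 4 ^ D"
  define r where "r = (2::real) powr (e - 1)"
  have K: "1 \<le> K"
  proof -
    have "1 \<le> real D ^ 2" using D by simp
    moreover have "1 \<le> (4::real) ^ D" by simp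
    ultimately have "1 * 1 \<le> real D ^ 2 * 4 ^ D" by (intro mult_mono) auto
    then show ?thesis by (simp add: K_def)
  qed
  have two: "2 ^ (h - i) = 2 powr real h * (2::real) powr - real i" if "i < h" for i
    using that by (simp add: powr_add[symmetric] powr_realpow[symmetric] of_nat_diff)
  have rpow: "r ^ j = 2 powr (real j * (e - 1))" for j
    by (simp add: r_def powr_powr powr_realpow[symmetric] mult.commute)
  have dens: "2 ^ (h - i) * density D h i j \<le>
      K * ((2 powr real h) powr (1 - e) * r ^ i) * ((2 ^ j) powr e + real h powr e)" if i: "i < h" for i j
  proof -
    define N where "N = (2::real) ^ (h - i)"
    \<comment> \<open>The power of a maximum is at most the sum of the powers, which separates 2^j
      from h.\<close>
    define M where "M = max (2 ^ j) (real h)"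
    have N: "N > 0" by (simp add: N_def)
    have M: "M > 0" by (simp add: M_def less_max_iff_disj)
    have "real (threshold D j + h) \<le> 4 * real D * M + real D * M"
    proof -
      have "real (threshold D j) = 4 * real D * 2 ^ j" by (simp add: threshold_def)
      also have "\<dots> \<le> 4 * real D * M" by (intro mult_left_mono) (auto simp: M_def)
      finally have "real (threshold D j) \<le> 4 * real D * M" .
      moreover have "1 * real h \<le> real D * M" using D by (intro mult_mono) (auto simp: M_def)
      ultimately show ?thesis unfolding of_nat_add by linarith
    qed
    \<comment> \<open>Rounding 4 + 1 up to 8 produces 1024 = 128 * 8 in \<open>K\<close>.\<close>
    also have "\<dots> \<le> 8 * real D * M" using M by simp
    finally have "128 * real D * 4 ^ D * real (threshold D j + h) \<le> 128 * real D * 4 ^ D * (8 * real D * M)"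
      by (intro mult_left_mono) auto
    also have "\<dots> = K * M" by (simp add: K_def power2_eq_square)
    finally have "(128 * real D * 4 ^ D * real (threshold D j + h) / N) powr e \<le> (K * M / N) powr e"
      using N e by (intro powr_mono2 divide_right_mono) auto
    also have "\<dots> = K powr e * (M powr e * N powr (- e))"
      using K M N by (simp add: powr_divide powr_mult powr_minus_divide)
    also have "\<dots> \<le> K * (((2 ^ j) powr e + real h powr e) * N powr (- e))"
    proof (intro mult_mono)
      show "K powr e \<le> K" using powr_le_self K e by simp
      show "M powr e \<le> (2 ^ j) powr e + real h powr e" by (auto simp: M_def max_def)
    qed (use K in auto)
    finally have "density D h i j \<le> K * (((2 ^ j) powr e + real h powr e) * N powr (- e))"
      unfolding density_def N_def e_def by linarith
    then have "N * density D h i j \<le> N * (K * (((2 ^ j) powr e + real h powr e) * N powr (- e)))"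
      using N by (intro mult_left_mono) auto
    also have "\<dots> = K * (N powr 1 * N powr (- e)) * ((2 ^ j) powr e + real h powr e)"
      using N by simp
    also have "N powr 1 * N powr (- e) = N powr (1 - e)" by (simp only: powr_add[symmetric]) simp
    also have "N powr (1 - e) = (2 powr real h) powr (1 - e) * r ^ i"
      unfolding N_def two[OF i] rpow by (simp add: powr_mult powr_powr algebra_simps)
    finally show ?thesis by (simp add: N_def)
  qed
  have geo: "(\<Sum>j<h. r ^ j) \<le> 4 * real h powr e"
    using sum_geometric_le[OF D h] by (simp add: r_def e_def)
  have J: "(\<Sum>j<h. 2 ^ (h - j) * ((2 ^ j) powr e + real h powr e)) \<le> 2 powr real h * (6 * real h powr e)"
  proof -
    have "(\<Sum>j<h. 2 ^ (h - j) * ((2 ^ j) powr e + real h powr e))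
       = (\<Sum>j<h. 2 powr real h * (r ^ j + (1/2) ^ j * real h powr e))"
    proof (intro sum.cong refl)
      fix j assume "j \<in> {..<h}"
      then have j: "j < h" by simp
      have "2 powr - real j * (2 ^ j) powr e = r ^ j"
        unfolding rpow by (simp add: powr_realpow[symmetric] powr_powr powr_add[symmetric] algebra_simps)
      moreover have "(2::real) powr - real j = inverse (2 ^ j)"
        by (simp add: powr_minus powr_realpow)
      moreover have "inverse (2 ^ j) = (1/2 :: real) ^ j"
        by (simp add: power_one_over inverse_eq_divide)
      ultimately show "2 ^ (h - j) * ((2 ^ j) powr e + real h powr e)
          = 2 powr real h * (r ^ j + (1/2) ^ j * real h powr e)"
        unfolding two[OF j] by (simp only: distrib_left mult.assoc)
    qed
    also have "\<dots> = 2 powr real h * ((\<Sum>j<h. r ^ j) + (\<Sum>j<h. (1/2) ^ j) * real h powr e)"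
      by (simp only: sum_distrib_left sum_distrib_right sum.distrib distrib_left)
    also have "\<dots> \<le> 2 powr real h * (4 * real h powr e + 2 * real h powr e)"
    proof (intro mult_left_mono add_mono mult_right_mono geo)
      have "(\<Sum>j<h. (1 / 2 :: real) ^ j) \<le> (\<Sum>j. (1 / 2) ^ j)"
        by (intro sum_le_suminf summable_geometric) auto
      then show "(\<Sum>j<h. (1 / 2 :: real) ^ j) \<le> 2" by (simp add: suminf_geometric)
    qed auto
    finally show ?thesis by simp
  qed
  have "(\<Sum>i<h. 4 * real D * 2 ^ (h - i) * (\<Sum>a\<in>levels h. density D h i (fst a)))
     = (\<Sum>i<h. 4 * real D * (\<Sum>j<h. 2 ^ (h - j) * (2 ^ (h - i) * density D h i j)))"
    by (intro sum.cong refl) (simp add: sum_levels sum_distrib_left mult_ac)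
  also have "\<dots> \<le> (\<Sum>i<h. 4 * real D * (\<Sum>j<h. 2 ^ (h - j) *
       (K * ((2 powr real h) powr (1 - e) * r ^ i) * ((2 ^ j) powr e + real h powr e))))"
    using dens by (intro sum_mono mult_left_mono) auto
  also have "\<dots> = 4 * real D * K * (2 powr real h) powr (1 - e) * (\<Sum>i<h. r ^ i) *
      (\<Sum>j<h. 2 ^ (h - j) * ((2 ^ j) powr e + real h powr e))"
    by (simp add: sum_distrib_left sum_distrib_right mult_ac)
  also have "\<dots> \<le> 4 * real D * K * (2 powr real h) powr (1 - e) * (4 * real h powr e) *
      (2 powr real h * (6 * real h powr e))"
    using K by (intro mult_mono geo J order_refl mult_nonneg_nonneg sum_nonneg) (auto simp: r_def)
  \<comment> \<open>96 = 4 * 4 * 6, and 96 * 1024 = 98304.\<close>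
  also have "\<dots> = 96 * real D * K * ((2 powr real h) powr (1 - e) * (2 powr real h) powr 1) *
      (real h powr e * real h powr e)"
    by simp
  also have "(2 powr real h) powr (1 - e) * (2 powr real h) powr 1 = (2 powr real h) powr (2 - e)"
    by (simp only: powr_add[symmetric]) simp
  also have "real h powr e * real h powr e = real h powr (2 * e)"
    by (simp only: powr_add[symmetric]) simp
  finally show ?thesis by (simp add: K_def power3_eq_cube power2_eq_square mult_ac)
qed

section \<open>Choice of the height and absorption of the constant\<close>

lemma eventually_ln_ln_ge: "eventually (\<lambda>n. K \<le> 80000 * (ln (ln (real n))) ^ 5) sequentially"
proof -
  have "filterlim (\<lambda>n. 80000 * (ln (ln (real n))) ^ 5) at_top sequentially" by real_asymp
  then show ?thesis by (simp add: filterlim_at_top)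
qed

lemma exists_height:
  assumes "n \<ge> 4"
  shows "\<exists>h>0. 2 * n \<le> 2 ^ h \<and> 2 powr real h \<le> 4 * real n \<and> real h \<le> 4 * ln (real n)"
proof -
  define h where "h = (LEAST h. 2 * n \<le> 2 ^ h)"
  have ex: "2 * n \<le> 2 ^ (2 * n)" using less_exp[of "2 * n"] by simp
  then have h: "2 * n \<le> 2 ^ h" unfolding h_def by (rule LeastI)
  then obtain k where k: "h = Suc k" using assms by (cases h) auto
  \<comment> \<open>Minimality of \<open>h\<close> gives 2^(h-1) < 2n, hence the upper bound
    4n.\<close>
  have "\<not> 2 * n \<le> 2 ^ k" unfolding h_def by (rule not_less_Least) (simp add: k flip: h_def)
  then have "2 ^ h \<le> 4 * n" unfolding k by simp
  then have "real (2 ^ h) \<le> real (4 * n)" by (simp only: of_nat_le_iff)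
  then have le: "2 powr real h \<le> 4 * real n" by (simp add: powr_realpow)
  have "ln (2 powr real h) \<le> ln (4 * real n)" using le assms by (subst ln_le_cancel_iff) auto
  also have "\<dots> = ln 4 + ln (real n)" using assms by (simp add: ln_mult)
  also have "ln 4 \<le> ln (real n)" using assms by (subst ln_le_cancel_iff) auto
  finally have "real h * ln 2 \<le> 2 * ln (real n)" by (simp add: ln_powr)
  \<comment> \<open>The logarithm inequality at 1/2 gives ln 2 \<ge> 1/2.\<close>
  moreover have "real h * (1/2) \<le> real h * ln 2"
    using ln_le_minus_one[of "1/2 :: real"] by (intro mult_left_mono) (auto simp: ln_div)
  ultimately have "real h \<le> 4 * ln (real n)" by linarith
  then show ?thesis using h le k by auto
qed

theorem theorem1p3:
  fixes D :: nat
  assumes "D \<ge> 1"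
  shows "\<exists>n0::nat. \<forall>n\<ge>n0. \<exists>(V::nat set) (E::nat set set).
           simple_graph V E \<and>
           real (card E) \<le> 80000 * real n powr (2 - 1 / real D) * ln (real n) powr (2 / real D)
                              * (ln (ln (real n))) ^ 5 \<and>
           universal n D V E"
proof -
  define e where "e = 1 / real D"
  define K where "K = 98304 * real D ^ 3 * 4 ^ D"
  have e: "0 < e" "e \<le> 1" and D: "D > 0" using assms by (auto simp: e_def)
  have K: "K \<ge> 0" by (simp add: K_def)
  obtain n1 where n1: "\<And>n. n \<ge> n1 \<Longrightarrow> 256 * K \<le> 80000 * (ln (ln (real n))) ^ 5"
    using eventually_ln_ln_ge[of "256 * K"] unfolding eventually_sequentially by blast
  show ?thesis
  proof (intro exI[of _ "max 4 n1"] allI impI)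
    fix n assume "max 4 n1 \<le> n"
    then have n: "n \<ge> 4" "n \<ge> n1" by auto
    obtain h where h: "h > 0" "2 * n \<le> 2 ^ h" "2 powr real h \<le> 4 * real n" "real h \<le> 4 * ln (real n)"
      using exists_height[OF n(1)] by blast
    obtain V :: "nat set" and E where VE: "simple_graph V E" "universal n D V E"
      "real (card E) \<le> (\<Sum>i<h. 4 * real D * 2 ^ (h - i) * (\<Sum>a\<in>levels h. density D h i (fst a)))"
      using universal_graph_exists[OF D h(1,2)] by blast
    have ln_pos: "0 \<le> ln (real n)" using n by simp
    have "real (card E) \<le> K * (2 powr real h) powr (2 - e) * real h powr (2 * e)"
      using VE(3) sum_density_le[OF D h(1)] unfolding K_def e_def by linarith
    also have "\<dots> \<le> K * (4 * real n) powr (2 - e) * (4 * ln (real n)) powr (2 * e)"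
      using h(3,4) e K by (intro mult_mono mult_left_mono powr_mono2) auto
    also have "\<dots> = K * (4 powr (2 - e) * 4 powr (2 * e)) * (real n powr (2 - e) * ln (real n) powr (2 * e))"
      using ln_pos by (simp add: powr_mult)
    \<comment> \<open>The factors 4 come from 2^h \<le> 4n and h \<le> 4 ln n; both exponents are at
      most 2, which gives 256.\<close>
    also have "\<dots> \<le> K * (4 powr 2 * 4 powr 2) * (real n powr (2 - e) * ln (real n) powr (2 * e))"
      using e K by (intro mult_right_mono mult_left_mono mult_mono powr_mono) auto
    also have "\<dots> = (256 * K) * (real n powr (2 - e) * ln (real n) powr (2 * e))" by simp
    also have "\<dots> \<le> (80000 * (ln (ln (real n))) ^ 5) * (real n powr (2 - e) * ln (real n) powr (2 * e))"
      using n1[OF n(2)] by (intro mult_right_mono) auto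
    finally have "real (card E) \<le> 80000 * real n powr (2 - 1 / real D) * ln (real n) powr (2 / real D)
                              * (ln (ln (real n))) ^ 5"
      by (simp add: e_def mult_ac)
    then show "\<exists>(V::nat set) (E::nat set set). simple_graph V E \<and>
           real (card E) \<le> 80000 * real n powr (2 - 1 / real D) * ln (real n) powr (2 / real D)
                              * (ln (ln (real n))) ^ 5 \<and> universal n D V E"
      using VE(1,2) by blast
  qed
qed

end
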